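(* Let $n\ge3$ and let $K:\mathbb{R}^n\to[0,\infty)$ be smooth, not identically zero, with $\int_{\mathbb{R}^n}K\,dx<\infty$ and $K(x)=O(|x|^{-\ell})$ as $|x|\to\infty$ for some $\ell>2$. Then there is a number $\beta_0>0$ such that for every $\beta\in(0,\beta_0)$ the equation $$\Delta u+K(x)\,u^{\frac{n}{n-2}}=0\quad\text{in }\mathbb{R}^n$$ has a minimal positive solution $u^{(\beta)}$ satisfying $u^{(\beta)}\ge\beta$ on $\mathbb{R}^n$ and $\lim_{|x|\to\infty}u^{(\beta)}(x)=\beta$. Here minimal means that every nonnegative solution $w$ with $w(x)\to\beta$ as $|x|\to\infty$ satisfies $w\ge u^{(\beta)}$. Moreover, the family $\{u^{(\beta)}\}_{0<\beta<\beta_0}$ depends continuously on $\beta$ and is monotone increasing in $\beta$ (for each fixed $x$). *)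

theory Defs
  imports "HOL-Analysis.Analysis"
begin

definition partial :: "'n::finite \<Rightarrow> (real^'n \<Rightarrow> real) \<Rightarrow> real^'n \<Rightarrow> real" where
  "partial i f x = deriv (\<lambda>t. f (x + t *\<^sub>R axis i 1)) 0"

fun pd :: "'n::finite list \<Rightarrow> (real^'n \<Rightarrow> real) \<Rightarrow> real^'n \<Rightarrow> real" where
  "pd [] f = f"
| "pd (i # is) f = partial i (pd is f)"

definition Ck :: "nat \<Rightarrow> (real^'n::finite \<Rightarrow> real) \<Rightarrow> bool" where
  "Ck k f \<longleftrightarrow> (\<forall>is. length is \<le> k \<longrightarrow> continuous_on UNIV (pd is f)) \<and>
     (\<forall>is i x. length is < k \<longrightarrow>
        ((\<lambda>t. pd is f (x + t *\<^sub>R axis i 1)) has_real_derivative pd (i # is) f x) (at 0))"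

definition smooth :: "(real^'n::finite \<Rightarrow> real) \<Rightarrow> bool" where
  "smooth f \<longleftrightarrow> (\<forall>k. Ck k f)"

definition laplacian :: "(real^'n::finite \<Rightarrow> real) \<Rightarrow> real^'n \<Rightarrow> real" where
  "laplacian u x = (\<Sum>i\<in>UNIV. pd [i, i] u x)"

definition is_solution :: "(real^'n::finite \<Rightarrow> real) \<Rightarrow> (real^'n \<Rightarrow> real) \<Rightarrow> bool" where
  "is_solution K u \<longleftrightarrow> Ck 2 u \<and>
     (\<forall>x. laplacian u x + K x * u x powr (real CARD('n) / (real CARD('n) - 2)) = 0)"

end

(* The solution is built as a fixed point of u = beta + N(K u^p), p = n/(n-2), where N is the
   Newtonian potential. To avoid singular integrals and surface integrals, the kernel |z|^(2-n) is
   replaced inside the ball of radius 2^-m by a Taylor polynomial in |z|^2, which gives a C^2 kernel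
   G_m. The increments G_(m+1) - G_m are supported in that ball, so that for continuous integrable f
   the convolutions G_m * f and their first derivatives converge geometrically; if f is C^1, moving
   one derivative to f gives the same for the second derivatives. Since -Laplace G_m is an
   approximate identity, the limit satisfies Laplace N f = -f after normalisation.
   For small beta the map is a contraction with factor 1/2 on [0, 2 beta_0]; the iterates starting
   from the constant beta increase in beta and are Lipschitz in beta uniformly in the step.
   If w is a solution with limit beta, the maximum principle gives w >= beta and then
   w >= beta + N(K w^p), so w dominates all iterates and hence their limit. *)

theory Submission
  imports Defs
begin

section \<open>Partial derivatives and limits\<close>

text \<open>The scales are dictated by homogeneity. With a = (n-2)/2 the kernel is (|z|^2)^(-a), and
  the increment at radius 2^-m has size about 4^(ma) on a ball of volume proportional to 2^(-mn),
  which gives 4^-m. The same count gives 2^-m for the gradient and no decay for the second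
  derivatives. Hence the source K u^p must be C^1 before its potential can be differentiated twice,
  and the chain rule for the power is applied where u > 0. For the constructed solution this follows
  from u >= beta. A competitor w is only known to be nonnegative, so the maximum principle is
  applied to w itself before its potential is considered; a second application, to w - N(K w^p),
  which is then harmonic with limit beta, gives the comparison with the potential. The contraction
  rests on p > 1: the Lipschitz constant p B^(p-1) of t^p on [0, B] tends to 0 with B, while N K is
  bounded.\<close>

definition has_partial :: "'n::finite \<Rightarrow> (real^'n \<Rightarrow> real) \<Rightarrow> (real^'n \<Rightarrow> real) \<Rightarrow> bool" where
  "has_partial i f f' \<longleftrightarrow>
     (\<forall>x. ((\<lambda>t. f (x + t *\<^sub>R axis i 1)) has_real_derivative f' x) (at 0))"

lemma has_partialD:
  assumes "has_partial i f f'"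
  shows "((\<lambda>t. f (x + t *\<^sub>R axis i 1)) has_real_derivative f' (x + t *\<^sub>R axis i 1)) (at t)"
proof -
  have "((\<lambda>s. f ((x + t *\<^sub>R axis i 1) + s *\<^sub>R axis i 1)) has_real_derivative f' (x + t *\<^sub>R axis i 1)) (at 0)"
    using assms by (auto simp: has_partial_def)
  then have "((\<lambda>s. f (x + (s + t) *\<^sub>R axis i 1)) has_real_derivative f' (x + t *\<^sub>R axis i 1)) (at 0)"
    by (simp add: algebra_simps)
  then show ?thesis
    using DERIV_shift[of "\<lambda>t. f (x + t *\<^sub>R axis i 1)" "f' (x + t *\<^sub>R axis i 1)" 0 t]
    by simp
qed

lemma has_partial_unique: "has_partial i f g \<Longrightarrow> has_partial i f g' \<Longrightarrow> g = g'"
  unfolding has_partial_def by (meson DERIV_unique ext)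

lemma partial_eqI: "has_partial i f g \<Longrightarrow> partial i f = g"
  unfolding has_partial_def partial_def by (auto intro!: DERIV_imp_deriv)

lemma has_partial_diff:
  "has_partial i f f' \<Longrightarrow> has_partial i g g' \<Longrightarrow> has_partial i (\<lambda>x. f x - g x) (\<lambda>x. f' x - g' x)"
  unfolding has_partial_def by (auto intro!: derivative_eq_intros)

lemma has_partial_add:
  "has_partial i f f' \<Longrightarrow> has_partial i g g' \<Longrightarrow> has_partial i (\<lambda>x. f x + g x) (\<lambda>x. f' x + g' x)"
  unfolding has_partial_def by (auto intro!: derivative_eq_intros)

lemma has_partial_const: "has_partial i (\<lambda>x. c) (\<lambda>x. 0)"
  unfolding has_partial_def by auto

lemma has_partial_uminus: "has_partial i f f' \<Longrightarrow> has_partial i (\<lambda>x. - f x) (\<lambda>x. - f' x)"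
  unfolding has_partial_def by (auto intro!: derivative_eq_intros)

lemma has_partial_divide: "has_partial i f f' \<Longrightarrow> has_partial i (\<lambda>x. f x / c) (\<lambda>x. f' x / c)"
  unfolding has_partial_def by (auto intro!: DERIV_cdivide)

lemma has_partial_mult:
  "has_partial i f f' \<Longrightarrow> has_partial i g g' \<Longrightarrow>
   has_partial i (\<lambda>x. f x * g x) (\<lambda>x. f' x * g x + f x * g' x)"
  unfolding has_partial_def by (auto intro!: derivative_eq_intros)

lemma has_partial_powr:
  assumes "has_partial i u u'" "\<And>x. u x > 0"
  shows "has_partial i (\<lambda>x. u x powr p) (\<lambda>x. p * u x powr (p - 1) * u' x)"
  unfolding has_partial_def
proof
  fix x
  show "((\<lambda>t. u (x + t *\<^sub>R axis i 1) powr p) has_real_derivative p * u x powr (p - 1) * u' x) (at 0)"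
    using assms by (auto simp: has_partial_def intro!: DERIV_fun_powr[of "\<lambda>t. u (x + t *\<^sub>R axis i 1)" "u' x" 0 p, simplified])
qed

text \<open>\<open>pd\<close> puts the newest derivative at the head of the list, so
  \<open>pd [i, j] f\<close> differentiates first in \<open>j\<close>, then in \<open>i\<close>.
  Enumerating the lists of length at most 2 turns \<open>Ck 2\<close> into statements about
  \<open>has_partial\<close>.\<close>

lemma Ck_2_iff:
  "Ck 2 f \<longleftrightarrow> continuous_on UNIV f \<and>
     (\<forall>i. continuous_on UNIV (pd [i] f) \<and> has_partial i f (pd [i] f)) \<and>
     (\<forall>i j. continuous_on UNIV (pd [i, j] f) \<and> has_partial i (pd [j] f) (pd [i, j] f))"
proof -
  have le: "(\<forall>is::'a list. length is \<le> 2 \<longrightarrow> P is) \<longleftrightarrow> P [] \<and> (\<forall>i. P [i]) \<and> (\<forall>i j. P [i, j])" for P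
    by (auto simp: le_Suc_eq length_Suc_conv numeral_2_eq_2)
  have lt: "(\<forall>is::'a list. \<forall>i x. length is < 2 \<longrightarrow> P is i x) \<longleftrightarrow>
      (\<forall>i x. P [] i x) \<and> (\<forall>i j x. P [j] i x)" for P
    by (auto simp: less_Suc_eq length_Suc_conv numeral_2_eq_2)
  show ?thesis
    unfolding Ck_def le lt has_partial_def by auto
qed

text \<open>The derivatives are supplied as explicit families; \<open>has_partial\<close> forces
  \<open>deriv\<close>, hence \<open>pd\<close>, to agree with them, so that the Laplacian can be
  read off from \<open>E\<close>.\<close>

lemma Ck_2I:
  assumes "continuous_on UNIV f"
    and "\<And>i. continuous_on UNIV (D i)" "\<And>i. has_partial i f (D i)"
    and "\<And>i j. continuous_on UNIV (E i j)" "\<And>i j. has_partial i (D j) (E i j)"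
  shows "Ck 2 f" and "pd [i, j] f = E i j"
proof -
  have 1: "pd [j] f = D j" for j
    using assms(3) by (auto simp: partial_eqI)
  have 2: "pd [i, j] f = E i j" for i j
    using 1[of j] assms(5) by (auto simp: partial_eqI)
  show "Ck 2 f"
    unfolding Ck_2_iff using assms 1 2 by auto
  show "pd [i, j] f = E i j" by (rule 2)
qed

section \<open>Differentiation under the integral sign\<close>

lemma has_real_derivative_lebesgue_integral:
  fixes g g' :: "real \<Rightarrow> 'a \<Rightarrow> real"
  assumes deriv: "\<And>t z. \<bar>t\<bar> < 1 \<Longrightarrow> ((\<lambda>t. g t z) has_real_derivative g' t z) (at t)"
    and int: "\<And>t. \<bar>t\<bar> < 1 \<Longrightarrow> integrable M (g t)"
    and bound: "\<And>t z. \<bar>t\<bar> < 1 \<Longrightarrow> \<bar>g' t z\<bar> \<le> H z"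
    and H: "integrable M H" and meas: "g' 0 \<in> borel_measurable M"
  shows "((\<lambda>t. LINT z|M. g t z) has_real_derivative (LINT z|M. g' 0 z)) (at 0)"
  unfolding DERIV_def LIMSEQ_SEQ_conv[symmetric]
proof safe
  fix S :: "nat \<Rightarrow> real" assume S: "\<forall>n. S n \<noteq> 0" "S \<longlonglongrightarrow> 0"
  then have "\<forall>\<^sub>F n in sequentially. dist (S n) 0 < 1"
    by (intro tendstoD) auto
  then obtain N where N: "\<And>n. n \<ge> N \<Longrightarrow> \<bar>S n\<bar> < 1"
    unfolding eventually_sequentially by auto
  \<comment> \<open>Dropping finitely many terms keeps the sequence inside the interval where the
    derivative and its bound are available.\<close>
  define T where "T n = S (n + N)" for n
  have T: "\<And>n. T n \<noteq> 0" "\<And>n. \<bar>T n\<bar> < 1" "T \<longlonglongrightarrow> 0"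
    using S N LIMSEQ_ignore_initial_segment[OF S(2)] by (auto simp: T_def[abs_def])
  \<comment> \<open>The mean value bound turns the domination of \<open>g'\<close> into a domination
    of the difference quotients, as dominated convergence requires.\<close>
  have quot: "\<bar>(g t z - g 0 z) / t\<bar> \<le> H z" if t: "\<bar>t\<bar> < 1" "t \<noteq> 0" for t z
  proof -
    have "norm (g t z - g 0 z) \<le> H z * norm (t - 0)"
    proof (rule field_differentiable_bound[where S="ball 0 1" and f' = "\<lambda>t. g' t z"])
      fix s :: real assume "s \<in> ball 0 1"
      then have s: "\<bar>s\<bar> < 1" by simp
      show "((\<lambda>t. g t z) has_field_derivative g' s z) (at s within ball 0 1)"
        using deriv[OF s] by (rule has_field_derivative_at_within)
      show "norm (g' s z) \<le> H z" using bound[OF s] by simp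
    qed (use t in auto)
    then show ?thesis using t by (simp add: field_simps)
  qed
  have "(\<lambda>n. LINT z|M. (g (T n) z - g 0 z) / T n) \<longlonglongrightarrow> (LINT z|M. g' 0 z)"
  proof (rule integral_dominated_convergence[where w=H])
    show "AE z in M. (\<lambda>n. (g (T n) z - g 0 z) / T n) \<longlonglongrightarrow> g' 0 z"
    proof (rule AE_I2)
      fix z
      have "(\<lambda>h. (g (0 + h) z - g 0 z) / h) \<midarrow>0\<rightarrow> g' 0 z"
        using deriv[of 0 z] by (simp add: DERIV_def)
      then show "(\<lambda>n. (g (T n) z - g 0 z) / T n) \<longlonglongrightarrow> g' 0 z"
        using T unfolding LIMSEQ_SEQ_conv[symmetric] by auto
    qed
    show "AE z in M. norm ((g (T n) z - g 0 z) / T n) \<le> H z" for n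
      using quot[OF T(2,1)] by auto
    show "(\<lambda>z. (g (T n) z - g 0 z) / T n) \<in> borel_measurable M" for n
      using int[OF T(2)[of n]] int[of 0] by (auto intro!: borel_measurable_divide borel_measurable_diff)
  qed (use H meas in auto)
  moreover have "(LINT z|M. (g (T n) z - g 0 z) / T n) = ((LINT z|M. g (T n) z) - (LINT z|M. g 0 z)) / T n" for n
    using int[OF T(2)[of n]] int[of 0] by simp
  ultimately have "(\<lambda>n. ((LINT z|M. g (T n) z) - (LINT z|M. g 0 z)) / T n) \<longlonglongrightarrow> (LINT z|M. g' 0 z)"
    by (simp only:)
  then show "(\<lambda>n. ((LINT z|M. g (0 + S n) z) - (LINT z|M. g 0 z)) / S n) \<longlonglongrightarrow> (LINT z|M. g' 0 z)"
    unfolding T_def using LIMSEQ_offset[where k=N and f="\<lambda>n. ((LINT z|M. g (S n) z) - (LINT z|M. g 0 z)) / S n"] by simp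
qed

section \<open>Locally uniform geometric convergence\<close>

lemma geometric_steps_bound:
  fixes g :: "nat \<Rightarrow> real"
  assumes "\<And>m. \<bar>g (Suc m) - g m\<bar> \<le> A * (1/2)^m"
  shows "\<bar>g (m + k) - g m\<bar> \<le> 2 * A * (1/2)^m"
proof -
  have A: "A \<ge> 0" using assms[of 0] by (simp; linarith)
  \<comment> \<open>The exact partial sum of the geometric series is kept so that the induction
    closes.\<close>
  have "\<bar>g (m + k) - g m\<bar> \<le> 2 * A * (1/2)^m * (1 - (1/2)^k)"
  proof (induction k)
    case (Suc k)
    have "\<bar>g (m + Suc k) - g m\<bar> \<le> \<bar>g (m + k) - g m\<bar> + A * (1/2)^(m+k)"
      using assms[of "m + k"] by (simp; linarith)
    also have "\<dots> \<le> 2 * A * (1/2)^m * (1 - (1/2)^k) + A * (1/2)^(m+k)"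
      using Suc by simp
    also have "\<dots> = 2 * A * (1/2)^m * (1 - (1/2)^Suc k)"
      by (simp add: algebra_simps power_add)
    finally show ?case .
  qed simp
  also have "\<dots> \<le> 2 * A * (1/2)^m"
    using A by (intro mult_left_le) auto
  finally show ?thesis .
qed

lemma geometric_steps_limit:
  fixes g :: "nat \<Rightarrow> real"
  assumes "\<And>m. \<bar>g (Suc m) - g m\<bar> \<le> A * (1/2)^m"
  shows "g \<longlonglongrightarrow> lim g" and "\<bar>lim g - g m\<bar> \<le> 2 * A * (1/2)^m"
proof -
  have lim0: "(\<lambda>m. 2 * A * (1/2)^m) \<longlonglongrightarrow> 0"
    using LIMSEQ_power_zero[of "1/2::real"] by (intro tendsto_mult_right_zero) auto
  have "Cauchy g"
  proof (rule CauchyI')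
    fix e :: real assume "e > 0"
    then have "\<forall>\<^sub>F m in sequentially. 2 * A * (1/2)^m < e"
      using lim0 order_tendstoD(2) by blast
    then obtain N where N: "\<And>m. m \<ge> N \<Longrightarrow> 2 * A * (1/2)^m < e"
      unfolding eventually_sequentially by auto
    show "\<exists>M. \<forall>m\<ge>M. \<forall>n>m. dist (g m) (g n) < e"
    proof (intro exI[of _ N] allI impI)
      fix m n assume "N \<le> m" "m < n"
      then show "dist (g m) (g n) < e"
        using geometric_steps_bound[of g A m "n - m", OF assms] N[of m]
        by (auto simp: dist_real_def abs_minus_commute)
    qed
  qed
  then show lim: "g \<longlonglongrightarrow> lim g"
    by (simp add: Cauchy_convergent_iff convergent_LIMSEQ_iff)
  have "(\<lambda>k. \<bar>g (m + k) - g m\<bar>) \<longlonglongrightarrow> \<bar>lim g - g m\<bar>"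
    using LIMSEQ_ignore_initial_segment[OF lim, of m] by (intro tendsto_intros) (simp add: add.commute)
  then show "\<bar>lim g - g m\<bar> \<le> 2 * A * (1/2)^m"
    by (rule LIMSEQ_le_const2) (use geometric_steps_bound[of g A, OF assms] in auto)
qed

text \<open>The constant may depend on the ball but not on \<open>m\<close>. This summable rate
  gives pointwise limits and uniform convergence on balls, hence continuity of the limit and
  exchange with partial derivatives.\<close>

definition loc_geometric :: "(nat \<Rightarrow> real^'n \<Rightarrow> real) \<Rightarrow> bool" where
  "loc_geometric g \<longleftrightarrow>
     (\<forall>R. \<exists>A. \<forall>m. \<forall>x\<in>cball 0 R. \<bar>g (Suc m) x - g m x\<bar> \<le> A * (1/2)^m)"

lemma loc_geometric_tendsto:
  assumes "loc_geometric g"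
  shows "(\<lambda>m. g m x) \<longlonglongrightarrow> lim (\<lambda>m. g m x)"
proof -
  obtain A where "\<And>m y. y \<in> cball 0 (norm x) \<Longrightarrow> \<bar>g (Suc m) y - g m y\<bar> \<le> A * (1/2)^m"
    using assms unfolding loc_geometric_def by metis
  then show ?thesis by (intro geometric_steps_limit) auto
qed

lemma loc_geometric_uniform_limit:
  assumes "loc_geometric g"
  shows "uniform_limit (cball 0 R) g (\<lambda>x. lim (\<lambda>m. g m x)) sequentially"
proof (rule uniform_limitI)
  fix e :: real assume "e > 0"
  obtain A where A: "\<And>m x. x \<in> cball 0 R \<Longrightarrow> \<bar>g (Suc m) x - g m x\<bar> \<le> A * (1/2)^m"
    using assms unfolding loc_geometric_def by metis
  have "(\<lambda>m. 2 * A * (1/2)^m) \<longlonglongrightarrow> 0"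
    using LIMSEQ_power_zero[of "1/2::real"] by (intro tendsto_mult_right_zero) auto
  then have "\<forall>\<^sub>F m in sequentially. 2 * A * (1/2)^m < e"
    using order_tendstoD(2) \<open>e > 0\<close> by blast
  then show "\<forall>\<^sub>F m in sequentially. \<forall>x\<in>cball 0 R. dist (g m x) (lim (\<lambda>m. g m x)) < e"
  proof eventually_elim
    case (elim m)
    then show ?case
      using geometric_steps_limit(2)[of "\<lambda>m. g m x" A m for x, OF A]
      by (fastforce simp: dist_real_def abs_minus_commute)
  qed
qed

lemma loc_geometric_continuous:
  fixes g :: "nat \<Rightarrow> real^'n \<Rightarrow> real"
  assumes "loc_geometric g" "\<And>m. continuous_on UNIV (g m)"
  shows "continuous_on UNIV (\<lambda>x. lim (\<lambda>m. g m x))"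
  unfolding continuous_on_eq_continuous_at[OF open_UNIV]
proof safe
  fix x :: "real^'n"
  have "continuous_on (cball 0 (norm x + 1)) (\<lambda>x. lim (\<lambda>m. g m x))"
    by (rule uniform_limit_theorem[OF _ loc_geometric_uniform_limit[OF assms(1)]])
       (auto intro!: always_eventually continuous_on_subset[OF assms(2)])
  then have "continuous_on (ball 0 (norm x + 1)) (\<lambda>x. lim (\<lambda>m. g m x))"
    by (rule continuous_on_subset) auto
  then show "isCont (\<lambda>x. lim (\<lambda>m. g m x)) x"
    by (rule continuous_on_interior) (auto simp: interior_open)
qed

text \<open>On the segment of half-length 1 through \<open>x\<close> in direction \<open>i\<close>,
  which stays in the ball of radius |x| + 1, the derivatives converge uniformly, so limit and
  derivative commute.\<close>

lemma loc_geometric_has_partial: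
  assumes g: "loc_geometric g" and d: "loc_geometric d" and D: "\<And>m. has_partial i (g m) (d m)"
  shows "has_partial i (\<lambda>x. lim (\<lambda>m. g m x)) (\<lambda>x. lim (\<lambda>m. d m x))"
  unfolding has_partial_def
proof
  fix x
  let ?p = "\<lambda>t. x + t *\<^sub>R axis i (1::real)"
  let ?S = "ball 0 1 :: real set"
  have in_ball: "?p t \<in> cball 0 (norm x + 1)" if "t \<in> ?S" for t
    using that norm_triangle_ineq[of x "t *\<^sub>R axis i 1"] by (auto simp: norm_axis_1)
  have "\<exists>G. \<forall>t\<in>?S. (\<lambda>m. g m (?p t)) \<longlonglongrightarrow> G t \<and>
     (G has_derivative (\<lambda>h. lim (\<lambda>m. d m (?p t)) * h)) (at t within ?S)"
  proof (rule has_derivative_sequence[where f' = "\<lambda>m t h. d m (?p t) * h" and ?x0.0 = 0])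
    show "((\<lambda>t. g m (?p t)) has_derivative (\<lambda>h. d m (?p t) * h)) (at t within ?S)" for m t
      using has_partialD[OF D, of m x t, THEN has_field_derivative_at_within, of ?S]
      by (simp add: has_field_derivative_def)
    show "(\<lambda>m. g m (?p 0)) \<longlonglongrightarrow> lim (\<lambda>m. g m x)"
      using loc_geometric_tendsto[OF g] by simp
    fix e :: real assume "e > 0"
    have "\<forall>\<^sub>F m in sequentially. \<forall>y\<in>cball 0 (norm x + 1). dist (d m y) (lim (\<lambda>m. d m y)) < e"
      using loc_geometric_uniform_limit[OF d] \<open>e > 0\<close> by (rule uniform_limitD)
    then show "\<forall>\<^sub>F m in sequentially. \<forall>t\<in>?S. \<forall>h.
        norm (d m (?p t) * h - lim (\<lambda>m. d m (?p t)) * h) \<le> e * norm h"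
    proof eventually_elim
      case (elim m)
      show ?case
      proof safe
        fix t h assume "t \<in> ?S"
        then have "\<bar>d m (?p t) - lim (\<lambda>m. d m (?p t))\<bar> \<le> e"
          using elim in_ball by (force simp: dist_real_def)
        then have "\<bar>d m (?p t) - lim (\<lambda>m. d m (?p t))\<bar> * \<bar>h\<bar> \<le> e * \<bar>h\<bar>"
          by (rule mult_right_mono) simp
        then show "norm (d m (?p t) * h - lim (\<lambda>m. d m (?p t)) * h) \<le> e * norm h"
          by (simp add: left_diff_distrib[symmetric] abs_mult)
      qed
    qed
  qed auto
  then obtain G where G: "\<And>t. t \<in> ?S \<Longrightarrow> (\<lambda>m. g m (?p t)) \<longlonglongrightarrow> G t"
     "\<And>t. t \<in> ?S \<Longrightarrow> (G has_derivative (\<lambda>h. lim (\<lambda>m. d m (?p t)) * h)) (at t within ?S)"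
    by blast
  have "(G has_real_derivative lim (\<lambda>m. d m x)) (at 0)"
    using G(2)[of 0] by (simp add: has_field_derivative_def at_within_open[of 0 ?S])
  then show "((\<lambda>t. lim (\<lambda>m. g m (?p t))) has_real_derivative lim (\<lambda>m. d m x)) (at 0)"
    by (rule has_field_derivative_transform_within_open[where S = ?S]) (auto intro!: G(1)[THEN limI, symmetric])
qed

section \<open>Convolutions\<close>

text \<open>The kernel is evaluated at \<open>y - x\<close>, so each derivative in \<open>x\<close>
  that falls on the kernel brings a minus sign. For an even kernel such as \<open>ker\<close> this
  is the ordinary convolution.\<close>

definition conv :: "(real^'n \<Rightarrow> real) \<Rightarrow> (real^'n \<Rightarrow> real) \<Rightarrow> real^'n \<Rightarrow> real" where
  "conv k f x = (LINT y|lborel. k (y - x) * f y)"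

text \<open>The substitution y = x + z moves \<open>x\<close> from the kernel into \<open>f\<close>.
  With both forms at hand, a derivative can fall on either factor.\<close>

lemma conv_translate:
  fixes k f :: "real^'n \<Rightarrow> real"
  assumes [measurable]: "k \<in> borel_measurable borel" "f \<in> borel_measurable borel"
  shows "conv k f x = (LINT z|lborel. k z * f (x + z))"
proof -
  have "conv k f x = (LINT y|distr lborel borel ((+) x). k (y - x) * f y)"
    unfolding conv_def lborel_distr_plus ..
  also have "\<dots> = (LINT z|lborel. k (x + z - x) * f (x + z))"
    by (rule integral_distr) auto
  finally show ?thesis by simp
qed

lemma continuous_imp_borel [measurable_dest]:
  fixes f :: "real^'n \<Rightarrow> real"
  shows "continuous_on UNIV f \<Longrightarrow> f \<in> borel_measurable borel"
  by (rule borel_measurable_continuous_onI)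

lemma integrable_imp_borel:
  fixes f :: "real^'n \<Rightarrow> real"
  shows "integrable lborel f \<Longrightarrow> f \<in> borel_measurable borel"
  by (auto dest: borel_measurable_integrable)

lemma continuous_bounded_on_cball:
  fixes f :: "real^'n \<Rightarrow> real"
  assumes "continuous_on UNIV f"
  obtains S where "\<And>y. y \<in> cball x r \<Longrightarrow> \<bar>f y\<bar> \<le> S"
proof -
  have "compact (f ` cball x r)"
    by (intro compact_continuous_image continuous_on_subset[OF assms]) auto
  then have "bounded (f ` cball x r)" by (rule compact_imp_bounded)
  then obtain S where "\<forall>y\<in>cball x r. \<bar>f y\<bar> \<le> S"
    by (auto simp: bounded_iff)
  then show thesis using that by blast
qed

lemma integrable_bounded_mult:
  fixes k f :: "real^'n \<Rightarrow> real"
  assumes [measurable]: "k \<in> borel_measurable borel" and f: "integrable lborel f"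
    and B: "\<And>z. \<bar>k z\<bar> \<le> B"
  shows "integrable lborel (\<lambda>y. k (y - x) * f y)"
proof (rule Bochner_Integration.integrable_bound)
  show "integrable lborel (\<lambda>y. B * f y)" using f by simp
  have [measurable]: "f \<in> borel_measurable borel" by (rule integrable_imp_borel[OF f])
  show "(\<lambda>y. k (y - x) * f y) \<in> borel_measurable lborel" by measurable
  have "\<bar>k z\<bar> \<le> \<bar>B\<bar>" for z using B[of z] by linarith
  then show "AE y in lborel. norm (k (y - x) * f y) \<le> norm (B * f y)"
    by (auto simp: abs_mult intro!: mult_right_mono)
qed

lemma conv_has_partial_kernel:
  fixes k k' f :: "real^'n \<Rightarrow> real"
  assumes k: "continuous_on UNIV k" "\<And>z. \<bar>k z\<bar> \<le> B" and k': "continuous_on UNIV k'" "\<And>z. \<bar>k' z\<bar> \<le> B'"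
    and D: "has_partial i k k'" and f: "integrable lborel f"
  shows "has_partial i (conv k f) (\<lambda>x. - conv k' f x)"
  unfolding has_partial_def
proof
  fix x
  let ?p = "\<lambda>t. x + t *\<^sub>R axis i (1::real)"
  note [measurable] = continuous_imp_borel[OF k(1)] continuous_imp_borel[OF k'(1)]
  have "((\<lambda>t. LINT y|lborel. k (y - ?p t) * f y) has_real_derivative
      (LINT y|lborel. - k' (y - ?p 0) * f y)) (at 0)"
  proof (rule has_real_derivative_lebesgue_integral[where H="\<lambda>y. B' * \<bar>f y\<bar>"])
    fix t y
    have "((\<lambda>t. k (y - x + t *\<^sub>R axis i 1)) has_real_derivative k' (y - x + (- t) *\<^sub>R axis i 1)) (at (- t))"
      by (rule has_partialD[OF D])
    then have "((\<lambda>t. k (y - x + (- t) *\<^sub>R axis i 1)) has_real_derivative k' (y - x + (- t) *\<^sub>R axis i 1) * (- 1)) (at t)"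
      by (rule DERIV_chain2) (auto intro!: derivative_eq_intros)
    then have "((\<lambda>t. k (y - ?p t)) has_real_derivative - k' (y - ?p t)) (at t)"
      by (simp add: algebra_simps)
    then show "((\<lambda>t. k (y - ?p t) * f y) has_real_derivative - k' (y - ?p t) * f y) (at t)"
      by (rule DERIV_cmult_right)
    show "\<bar>- k' (y - ?p t) * f y\<bar> \<le> B' * \<bar>f y\<bar>"
      by (auto simp: abs_mult intro!: mult_right_mono k')
    show "integrable lborel (\<lambda>y. k (y - ?p t) * f y)"
      by (rule integrable_bounded_mult[OF _ f k(2)]) simp
    show "integrable lborel (\<lambda>y. B' * \<bar>f y\<bar>)" using f by simp
    have [measurable]: "f \<in> borel_measurable borel" by (rule integrable_imp_borel[OF f])
    show "(\<lambda>y. - k' (y - ?p 0) * f y) \<in> borel_measurable lborel" by measurable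
  qed
  then show "((\<lambda>t. conv k f (?p t)) has_real_derivative - conv k' f x) (at 0)"
    by (simp add: conv_def)
qed

lemma conv_continuous:
  fixes k f :: "real^'n \<Rightarrow> real"
  assumes k: "continuous_on UNIV k" "\<And>z. \<bar>k z\<bar> \<le> B" and f: "integrable lborel f"
  shows "continuous_on UNIV (conv k f)"
  unfolding continuous_on_sequentially
proof (intro ballI allI impI, elim conjE)
  fix X and x :: "real^'n" assume X: "X \<longlonglongrightarrow> x"
  note [measurable] = continuous_imp_borel[OF k(1)]
  have [measurable]: "f \<in> borel_measurable borel" by (rule integrable_imp_borel[OF f])
  have "(\<lambda>n. LINT y|lborel. k (y - X n) * f y) \<longlonglongrightarrow> (LINT y|lborel. k (y - x) * f y)"
  proof (rule integral_dominated_convergence[where w = "\<lambda>y. B * \<bar>f y\<bar>"])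
    show "AE y in lborel. (\<lambda>n. k (y - X n) * f y) \<longlonglongrightarrow> k (y - x) * f y"
      using X by (intro AE_I2 tendsto_intros continuous_on_tendsto_compose[OF k(1)]) auto
    show "AE y in lborel. norm (k (y - X n) * f y) \<le> B * \<bar>f y\<bar>" for n
      by (intro AE_I2) (auto simp: abs_mult intro!: mult_right_mono k)
  qed (use f in auto)
  then show "(conv k f \<circ> X) \<longlonglongrightarrow> conv k f x" by (simp add: o_def conv_def)
qed

lemma content_cball_scale:
  fixes x :: "'a::euclidean_space"
  assumes "r \<ge> 0"
  shows "measure lborel (cball x r) = measure lborel (cball (0::'a) 1) * r ^ DIM('a)"
  using content_cball[OF assms, of x] content_cball[of 1 "0::'a"] by simp

text \<open>The integrand is dominated by \<open>B * S\<close> on the ball of radius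
  \<open>r\<close> about \<open>x\<close>. The explicit power of \<open>r\<close> later compensates
  the growth of the kernel increments as their supports shrink.\<close>

lemma conv_local_bound:
  fixes k f :: "real^'n \<Rightarrow> real"
  assumes k: "\<And>z. norm z \<le> r \<Longrightarrow> \<bar>k z\<bar> \<le> B" "\<And>z. norm z > r \<Longrightarrow> k z = 0"
    and f: "\<And>y. y \<in> cball x r \<Longrightarrow> \<bar>f y\<bar> \<le> S"
    and r: "r \<ge> 0"
  shows "\<bar>conv k f x\<bar> \<le> B * S * (measure lborel (cball (0::real^'n) 1) * r ^ CARD('n))"
proof -
  let ?H = "\<lambda>y. B * S * indicator (cball x r) y"
  have B: "B \<ge> 0" using k(1)[of 0] r abs_ge_zero[of "k 0"] by (simp; linarith)
  have S: "S \<ge> 0" using f[of x] r abs_ge_zero[of "f x"] by (simp; linarith)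
  have H: "integrable lborel ?H"
    using emeasure_bounded_finite[of "cball x r"]
    by (intro integrable_mult_right integrable_real_indicator) auto
  have le: "\<bar>k (y - x) * f y\<bar> \<le> ?H y" for y
  proof (cases "y \<in> cball x r")
    case True
    then have "\<bar>k (y - x)\<bar> \<le> B" "\<bar>f y\<bar> \<le> S"
      using k(1)[of "y - x"] f by (auto simp: dist_norm norm_minus_commute)
    then show ?thesis using True B by (auto simp: abs_mult intro!: mult_mono)
  next
    case False
    then have "k (y - x) = 0"
      using k(2)[of "y - x"] by (auto simp: dist_norm norm_minus_commute)
    then show ?thesis using B S by simp
  qed
  have 1: "conv k f x \<le> (LINT y|lborel. ?H y)"
    unfolding conv_def using le B S by (intro integral_mono'[OF H]) (auto simp: abs_le_iff)
  have "(LINT y|lborel. - (k (y - x) * f y)) \<le> (LINT y|lborel. ?H y)"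
    using le B S by (intro integral_mono'[OF H]) (auto simp: abs_le_iff)
  then have 2: "- conv k f x \<le> (LINT y|lborel. ?H y)" by (simp add: conv_def)
  have "(LINT y|lborel. ?H y) = B * S * measure lborel (cball x r)"
    by simp
  then show ?thesis
    using 1 2 content_cball_scale[OF r, of x] by auto
qed

lemma integrable_compact_support:
  fixes k :: "real^'n \<Rightarrow> real"
  assumes k: "continuous_on UNIV k" "\<And>z. norm z > r \<Longrightarrow> k z = 0"
  shows "integrable lborel k"
proof -
  have "integrable lborel (\<lambda>z. indicator (cball 0 r) z *\<^sub>R k z)"
    by (rule borel_integrable_compact) (auto intro: continuous_on_subset[OF k(1)])
  also have "(\<lambda>z. indicator (cball 0 r) z *\<^sub>R k z) = k"
    using k(2) by (auto simp: indicator_def fun_eq_iff)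
  finally show ?thesis .
qed

text \<open>Compact support of the kernel keeps the relevant arguments of \<open>f'\<close> within
  distance 1 + r of \<open>x\<close> while |t| < 1; there \<open>f'\<close> is bounded, which
  supplies the dominating function.\<close>

lemma conv_has_partial_function:
  fixes k f f' :: "real^'n \<Rightarrow> real"
  assumes k: "continuous_on UNIV k" "\<And>z. norm z > r \<Longrightarrow> k z = 0"
    and D: "has_partial i f f'" and f: "continuous_on UNIV f" "continuous_on UNIV f'"
  shows "has_partial i (conv k f) (conv k f')"
  unfolding has_partial_def
proof
  fix x
  let ?p = "\<lambda>t. x + t *\<^sub>R axis i (1::real)"
  note [measurable] = continuous_imp_borel[OF k(1)] continuous_imp_borel[OF f(1)] continuous_imp_borel[OF f(2)]
  obtain S where S: "\<And>y. y \<in> cball x (1 + r) \<Longrightarrow> \<bar>f' y\<bar> \<le> S"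
    using continuous_bounded_on_cball[OF f(2)] by blast
  have "((\<lambda>t. LINT z|lborel. k z * f (?p t + z)) has_real_derivative
      (LINT z|lborel. k z * f' (?p 0 + z))) (at 0)"
  proof (rule has_real_derivative_lebesgue_integral[where H="\<lambda>z. \<bar>k z\<bar> * S"])
    fix t :: real and z assume t: "\<bar>t\<bar> < 1"
    have "((\<lambda>t. f (x + z + t *\<^sub>R axis i 1)) has_real_derivative f' (x + z + t *\<^sub>R axis i 1)) (at t)"
      by (rule has_partialD[OF D])
    then have "((\<lambda>t. f (?p t + z)) has_real_derivative f' (?p t + z)) (at t)"
      by (simp add: algebra_simps)
    then show "((\<lambda>t. k z * f (?p t + z)) has_real_derivative k z * f' (?p t + z)) (at t)"
      by (rule DERIV_cmult)
    show "\<bar>k z * f' (?p t + z)\<bar> \<le> \<bar>k z\<bar> * S"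
    proof (cases "norm z > r")
      case False
      have "norm (?p t + z - x) \<le> 1 + r"
        using False t norm_triangle_ineq[of "t *\<^sub>R axis i (1::real)" z] by (auto simp: norm_axis_1)
      then have "?p t + z \<in> cball x (1 + r)"
        by (simp only: mem_cball dist_norm norm_minus_commute[of x])
      then show ?thesis by (auto simp: abs_mult intro!: mult_left_mono S)
    qed (use k(2) in auto)
  next
    show "integrable lborel (\<lambda>z. k z * f (?p t + z))" for t
    proof (rule integrable_compact_support[where r=r])
      show "continuous_on UNIV (\<lambda>z. k z * f (?p t + z))"
        by (intro continuous_intros k continuous_on_compose2[OF f(1)]) auto
    qed (use k(2) in auto)
    show "integrable lborel (\<lambda>z. \<bar>k z\<bar> * S)"
      using integrable_compact_support[OF k] by simp
    show "(\<lambda>z. k z * f' (?p 0 + z)) \<in> borel_measurable lborel" by measurable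
  qed
  then show "((\<lambda>t. conv k f (?p t)) has_real_derivative conv k f' x) (at 0)"
    by (simp add: conv_translate)
qed

lemma conv_diff_kernel:
  fixes k f :: "real^'n \<Rightarrow> real"
  assumes "continuous_on UNIV k" "\<And>z. \<bar>k z\<bar> \<le> B" "continuous_on UNIV k'" "\<And>z. \<bar>k' z\<bar> \<le> B'"
    and f: "integrable lborel f"
  shows "conv (\<lambda>z. k z - k' z) f x = conv k f x - conv k' f x"
proof -
  have "integrable lborel (\<lambda>y. k (y - x) * f y)" "integrable lborel (\<lambda>y. k' (y - x) * f y)"
    using assms by (auto intro!: integrable_bounded_mult simp: continuous_imp_borel)
  then show ?thesis by (simp add: conv_def algebra_simps)
qed

section \<open>Regularised Newtonian kernels\<close>

text \<open>Matching values and derivatives at \<open>c\<close> let the two branches join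
  differentiably. Applied once to the profile and once to its derivative.\<close>

lemma has_real_derivative_If_le:
  fixes f g :: "real \<Rightarrow> real"
  assumes "\<And>s. s \<le> c \<Longrightarrow> (f has_real_derivative f' s) (at s)"
    and "\<And>s. s \<ge> c \<Longrightarrow> (g has_real_derivative g' s) (at s)"
    and "f c = g c" "f' c = g' c"
  shows "((\<lambda>s. if s \<le> c then f s else g s) has_real_derivative (if s \<le> c then f' s else g' s)) (at s)"
proof -
  have "((\<lambda>s. if s \<in> {..c} then f s else g s) has_vector_derivative
      (if s \<in> {..c} then f' s else g' s)) (at s within UNIV)"
  proof (rule has_vector_derivative_If_within_closures[where T = "{c<..}"])
    show "(f has_vector_derivative f' s) (at s within {..c} \<union> closure {..c} \<inter> closure {c<..})"
      if "s \<in> {..c} \<union> closure {..c} \<inter> closure {c<..}"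
      using that assms(1)[of s]
      by (auto simp: has_real_derivative_iff_has_vector_derivative[symmetric] intro: has_field_derivative_at_within)
    show "(g has_vector_derivative g' s) (at s within {c<..} \<union> closure {..c} \<inter> closure {c<..})"
      if "s \<in> {c<..} \<union> closure {..c} \<inter> closure {c<..}"
      using that assms(2)[of s]
      by (auto simp: has_real_derivative_iff_has_vector_derivative[symmetric] intro: has_field_derivative_at_within)
    show "f s = g s" "f' s = g' s" if "s \<in> closure {..c}" "s \<in> closure {c<..}"
      using that assms(3,4) by (auto simp: order_antisym_conv)
  qed auto
  then show ?thesis
    by (simp add: has_real_derivative_iff_has_vector_derivative)
qed

text \<open>The profile \<^term>\<open>s powr (- a)\<close> is replaced below \<^term>\<open>s = 1\<close> by its second-order Taylor
  polynomial at \<^term>\<open>s = 1\<close>, which makes it twice continuously differentiable.\<close>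

definition prof :: "real \<Rightarrow> real \<Rightarrow> real" where
  "prof a s = (if s \<le> 1 then 1 - a * (s - 1) + a * (a + 1) / 2 * (s - 1)\<^sup>2 else s powr (- a))"

definition prof' :: "real \<Rightarrow> real \<Rightarrow> real" where
  "prof' a s = (if s \<le> 1 then - a + a * (a + 1) * (s - 1) else - a * s powr (- a - 1))"

definition prof'' :: "real \<Rightarrow> real \<Rightarrow> real" where
  "prof'' a s = (if s \<le> 1 then a * (a + 1) else a * (a + 1) * s powr (- a - 2))"

lemma DERIV_prof: "(prof a has_real_derivative prof' a s) (at s)"
  unfolding prof_def[abs_def] prof'_def
proof (rule has_real_derivative_If_le)
  fix s :: real
  show "((\<lambda>s. 1 - a * (s - 1) + a * (a + 1) / 2 * (s - 1)\<^sup>2) has_real_derivative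
      - a + a * (a + 1) * (s - 1)) (at s)"
    by (rule derivative_eq_intros refl | simp)+
  assume "s \<ge> 1"
  then show "((\<lambda>s. s powr (- a)) has_real_derivative - a * s powr (- a - 1)) (at s)"
    by (intro has_real_derivative_powr) simp
qed auto

lemma DERIV_prof': "(prof' a has_real_derivative prof'' a s) (at s)"
  unfolding prof'_def[abs_def] prof''_def
proof (rule has_real_derivative_If_le)
  fix s :: real
  show "((\<lambda>s. - a + a * (a + 1) * (s - 1)) has_real_derivative a * (a + 1)) (at s)"
    by (rule derivative_eq_intros refl | simp)+
  assume "s \<ge> 1"
  then have "((\<lambda>s. s powr (- a - 1)) has_real_derivative (- a - 1) * s powr (- a - 1 - 1)) (at s)"
    by (intro has_real_derivative_powr) simp
  from DERIV_cmult[OF this, of "- a"]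
  show "((\<lambda>s. - a * s powr (- a - 1)) has_real_derivative a * (a + 1) * s powr (- a - 2)) (at s)"
    by (simp add: algebra_simps)
qed auto

lemma continuous_prof: "continuous_on UNIV (prof a)" "continuous_on UNIV (prof' a)"
  by (rule DERIV_continuous_on, rule has_field_derivative_at_within, rule DERIV_prof)
     (rule DERIV_continuous_on, rule has_field_derivative_at_within, rule DERIV_prof')

lemma continuous_prof'': "continuous_on UNIV (prof'' a)"
proof -
  have "prof'' a = (\<lambda>s. a * (a + 1) * (max 1 s) powr (- a - 2))"
    by (auto simp: prof''_def max_def)
  then show ?thesis by (auto intro!: continuous_intros)
qed

lemma powr_neg_le_one: "s \<ge> 1 \<Longrightarrow> b \<ge> 0 \<Longrightarrow> s powr (- b) \<le> (1::real)"
  using powr_mono[of "- b" 0 s] by auto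

lemma prof_nonneg: "a > 0 \<Longrightarrow> prof a s \<ge> 0"
proof -
  assume "a > 0"
  then have "a * (s - 1) \<le> 0" if "s \<le> 1"
    using that by (simp add: mult_le_0_iff)
  then show ?thesis using \<open>a > 0\<close>
    by (auto simp: prof_def intro!: add_nonneg_nonneg)
qed

text \<open>The weight 1 + s records decay: it absorbs the factors \<open>z $ i\<close> and
  \<open>z $ i * z $ j\<close> in the derivatives of the kernel, which are at most 1 + q |z|^2 in
  modulus for q >= 1. The constant is a crude common bound for all three estimates.\<close>

lemma prof_bounds:
  assumes a: "a > 0" and s: "s \<ge> 0"
  shows "\<bar>prof a s\<bar> \<le> 2 * (a + 1) * (a + 2)"
    and "(1 + s) * \<bar>prof' a s\<bar> \<le> 2 * (a + 1) * (a + 2)"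
    and "(1 + s) * \<bar>prof'' a s\<bar> \<le> 2 * (a + 1) * (a + 2)"
proof -
  show "\<bar>prof a s\<bar> \<le> 2 * (a + 1) * (a + 2)"
  proof (cases "s \<le> 1")
    case True
    have "(1 - s)\<^sup>2 \<le> 1" using s True by (simp add: power_le_one)
    then have "a * (a + 1) / 2 * (s - 1)\<^sup>2 \<le> a * (a + 1) / 2"
      using a by (intro mult_left_le) (auto simp: power2_commute)
    moreover have "a * (1 - s) \<le> a" using a s True by (intro mult_left_le) auto
    moreover have "prof a s = 1 + a * (1 - s) + a * (a + 1) / 2 * (s - 1)\<^sup>2"
      using True by (simp add: prof_def right_diff_distrib)
    ultimately have "prof a s \<le> 1 + a + a * (a + 1) / 2"
      by linarith
    also have "\<dots> \<le> 2 * (a + 1) * (a + 2)" using a by (simp add: field_simps)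
    finally show ?thesis using prof_nonneg[OF a, of s] by simp
  next
    case False
    then have "prof a s \<le> 1" using a powr_neg_le_one[of s a] by (simp add: prof_def)
    also have "\<dots> \<le> 2 * (a + 1) * (a + 2)" using a by (simp add: field_simps)
    finally show ?thesis using prof_nonneg[OF a, of s] by simp
  qed
  show "(1 + s) * \<bar>prof' a s\<bar> \<le> 2 * (a + 1) * (a + 2)"
  proof (cases "s \<le> 1")
    case True
    have *: "a * (a + 1) * (1 - s) \<le> a * (a + 1)" "a * (a + 1) * (1 - s) \<ge> 0"
      using a s True by (auto intro!: mult_left_le)
    have "\<bar>prof' a s\<bar> \<le> a + a * (a + 1)"
      using True * a by (simp add: prof'_def algebra_simps)
    then have "(1 + s) * \<bar>prof' a s\<bar> \<le> 2 * (a + a * (a + 1))"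
      using True s by (intro mult_mono) auto
    also have "\<dots> \<le> 2 * (a + 1) * (a + 2)" using a by (simp add: field_simps)
    finally show ?thesis .
  next
    case False
    have "(1 + s) * (a * s powr (- a - 1)) \<le> (2 * s) * (a * s powr (- a - 1))"
      using False a by (intro mult_right_mono) auto
    also have "\<dots> = 2 * a * s powr (- a)"
      using False by (simp add: powr_diff)
    also have "\<dots> \<le> 2 * a" using False a powr_neg_le_one[of s a] by (intro mult_left_le) auto
    also have "\<dots> \<le> 2 * (a + 1) * (a + 2)" using a by (simp add: field_simps)
    finally show ?thesis using False a by (simp add: prof'_def abs_mult)
  qed
  show "(1 + s) * \<bar>prof'' a s\<bar> \<le> 2 * (a + 1) * (a + 2)"
  proof (cases "s \<le> 1")
    case True
    then have "(1 + s) * \<bar>prof'' a s\<bar> \<le> 2 * (a * (a + 1))"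
      using a s by (intro mult_mono) (auto simp: prof''_def)
    also have "\<dots> \<le> 2 * (a + 1) * (a + 2)" using a by (simp add: field_simps)
    finally show ?thesis .
  next
    case False
    have "(1 + s) * (a * (a + 1) * s powr (- a - 2)) \<le> (2 * s) * (a * (a + 1) * s powr (- a - 2))"
      using False a by (intro mult_right_mono) auto
    also have "\<dots> = 2 * (a * (a + 1)) * s powr (- (a + 1))"
      using False by (simp add: powr_diff powr_minus powr_add field_simps power2_eq_square)
    also have "\<dots> \<le> 2 * (a * (a + 1))" using False a powr_neg_le_one[of s "a + 1"] by (intro mult_left_le) auto
    also have "\<dots> \<le> 2 * (a + 1) * (a + 2)" using a by (simp add: field_simps)
    finally show ?thesis using False a by (simp add: prof''_def abs_mult)
  qed
qed

text \<open>On s >= 1 the profile is the pure power s^(-a), so the powers of \<open>q\<close>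
  cancel: outside a small ball the kernel forgets the regularisation parameter.\<close>

lemma prof_scale:
  assumes "q > 0" "q * s \<ge> 1"
  shows "q powr a * prof a (q * s) = s powr (- a)"
    and "q powr (a + 1) * prof' a (q * s) = - a * s powr (- a - 1)"
proof -
  have s: "s > 0" using assms by (smt (verit) zero_less_mult_pos)
  have "prof a t = t powr (- a)" "prof' a t = - a * t powr (- a - 1)" if "t \<ge> 1" for t
    using that by (auto simp: prof_def prof'_def)
  note * = this[OF assms(2)]
  have "q powr b * (q * s) powr (- b) = s powr (- b)" for b
    using assms(1) s by (simp add: powr_mult powr_minus)
  note ** = this[of a] this[of "a + 1"]
  show "q powr a * prof a (q * s) = s powr (- a)"
    unfolding * by (rule **)
  have e: "- a - 1 = - (a + 1)" by simp
  show "q powr (a + 1) * prof' a (q * s) = - a * s powr (- a - 1)"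
    unfolding * e by (simp only: mult.left_commute[of "q powr (a + 1)"] **(2))
qed

text \<open>The Laplacian of g(|z|^2) on R^n is 4 s g''(s) + 2 n g'(s) at s = |z|^2. The relation n
  = 2 a + 2 makes s^(-a) harmonic, while the Taylor polynomial leaves a multiple of 1 - s, which
  vanishes at the gluing point.\<close>

lemma prof_laplace:
  assumes "s \<ge> 0" "n = 2 * a + 2"
  shows "4 * s * prof'' a s + 2 * n * prof' a s = - (a * n * (n + 2) * max 0 (1 - s))"
proof (cases "s \<le> 1")
  case True
  then show ?thesis by (simp add: prof'_def prof''_def assms(2) algebra_simps)
next
  case False
  then have "s * s powr (- a - 2) = s powr (- a - 1)"
    by (simp add: powr_diff power2_eq_square)
  then have "s * (4 * (a * (a + 1) * s powr (- a - 2))) = 4 * (a * (a + 1)) * s powr (- a - 1)"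
    by (metis (no_types, opaque_lifting) mult.assoc mult.left_commute)
  then show ?thesis using False by (simp add: prof'_def prof''_def assms(2) algebra_simps)
qed

text \<open>With \<^term>\<open>a = (n - 2) / 2\<close> this is the Newtonian kernel |z|^(2-n) outside the ball of
  radius \<open>1 / sqrt q\<close>, so kernels for different \<open>q\<close> differ only near the origin.\<close>

definition ker :: "real \<Rightarrow> real \<Rightarrow> real^'n \<Rightarrow> real" where
  "ker a q z = q powr a * prof a (q * (norm z)\<^sup>2)"

definition ker1 :: "real \<Rightarrow> real \<Rightarrow> 'n \<Rightarrow> real^'n \<Rightarrow> real" where
  "ker1 a q i z = 2 * (z $ i) * (q powr (a + 1) * prof' a (q * (norm z)\<^sup>2))"

definition ker2 :: "real \<Rightarrow> real \<Rightarrow> 'n \<Rightarrow> 'n \<Rightarrow> real^'n \<Rightarrow> real" where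
  "ker2 a q i j z = 4 * (z $ i) * (z $ j) * (q powr (a + 2) * prof'' a (q * (norm z)\<^sup>2))
     + (if i = j then 2 * (q powr (a + 1) * prof' a (q * (norm z)\<^sup>2)) else 0)"

lemma norm_add_axis_sq:
  "(norm (z + t *\<^sub>R axis i (1::real)))\<^sup>2 = (norm z)\<^sup>2 + 2 * t * z $ i + t\<^sup>2"
  unfolding power2_norm_eq_inner
  by (simp add: inner_add_left inner_add_right inner_axis inner_axis_axis
      inner_commute[of "axis i 1" z] power2_eq_square algebra_simps)

lemma DERIV_norm_sq_axis:
  "((\<lambda>t. q * (norm (z + t *\<^sub>R axis i (1::real)))\<^sup>2) has_real_derivative 2 * q * z $ i) (at 0)"
  unfolding norm_add_axis_sq by (auto intro!: derivative_eq_intros)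

lemma ker_has_partial:
  assumes "q > 0"
  shows "has_partial i (ker a q) (ker1 a q i)"
  unfolding has_partial_def
proof
  fix z :: "real^'a"
  have "((\<lambda>t. prof a (q * (norm (z + t *\<^sub>R axis i (1::real)))\<^sup>2)) has_real_derivative
      prof' a (q * (norm z)\<^sup>2) * (2 * q * z $ i)) (at 0)"
    by (rule DERIV_chain2[OF _ DERIV_norm_sq_axis]) (simp add: DERIV_prof)
  from DERIV_cmult[OF this, of "q powr a"]
  show "((\<lambda>t. ker a q (z + t *\<^sub>R axis i 1)) has_real_derivative ker1 a q i z) (at 0)"
    using assms by (simp add: ker_def ker1_def powr_add algebra_simps)
qed

lemma ker1_has_partial:
  assumes "q > 0"
  shows "has_partial i (ker1 a q j) (ker2 a q i j)"
  unfolding has_partial_def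
proof
  fix z :: "real^'a"
  have 1: "((\<lambda>t. prof' a (q * (norm (z + t *\<^sub>R axis i (1::real)))\<^sup>2)) has_real_derivative
      prof'' a (q * (norm z)\<^sup>2) * (2 * q * z $ i)) (at 0)"
    by (rule DERIV_chain2[OF _ DERIV_norm_sq_axis]) (simp add: DERIV_prof')
  have 2: "((\<lambda>t. 2 * ((z + t *\<^sub>R axis i (1::real)) $ j)) has_real_derivative (if i = j then 2 else 0)) (at 0)"
    by (auto intro!: derivative_eq_intros simp: axis_def)
  have pw: "q powr (a + 2) = q powr (a + 1) * q"
    using assms by (simp add: powr_add power2_eq_square)
  from DERIV_mult[OF 2 DERIV_cmult[OF 1, of "q powr (a + 1)"]]
  show "((\<lambda>t. ker1 a q j (z + t *\<^sub>R axis i 1)) has_real_derivative ker2 a q i j z) (at 0)"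
    unfolding ker1_def ker2_def pw by (rule DERIV_cong) (auto simp: algebra_simps)
qed

lemma continuous_ker:
  "continuous_on UNIV (ker a q)" "continuous_on UNIV (ker1 a q i)" "continuous_on UNIV (ker2 a q i j)"
proof -
  note [continuous_intros] = continuous_on_compose2[OF continuous_prof(1)]
    continuous_on_compose2[OF continuous_prof(2)] continuous_on_compose2[OF continuous_prof'']
  show "continuous_on UNIV (ker a q)" "continuous_on UNIV (ker1 a q i)"
    unfolding ker_def[abs_def] ker1_def[abs_def] by (auto intro!: continuous_intros)
  show "continuous_on UNIV (ker2 a q i j)"
    unfolding ker2_def[abs_def] by (cases "i = j") (auto intro!: continuous_intros)
qed

lemma ker_nonneg: "a > 0 \<Longrightarrow> ker a q z \<ge> 0"
  by (simp add: ker_def prof_nonneg)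

lemma ker_bound:
  assumes "a > 0" "q > 0"
  shows "\<bar>ker a q z\<bar> \<le> 2 * (a + 1) * (a + 2) * q powr a"
  using prof_bounds(1)[of a "q * (norm z)\<^sup>2"] assms
  by (simp add: ker_def abs_mult mult.commute mult_left_mono)

text \<open>The factor \<open>norm z\<close> is kept because it contributes the gain (1/2) ^ m on
  the support of a kernel increment.\<close>

lemma ker1_bound:
  assumes "a > 0" "q > 0"
  shows "\<bar>ker1 a q i z\<bar> \<le> 4 * (a + 1) * (a + 2) * q powr (a + 1) * norm z"
proof -
  let ?s = "q * (norm z)\<^sup>2"
  have s: "?s \<ge> 0" using assms by simp
  have "\<bar>prof' a ?s\<bar> \<le> (1 + ?s) * \<bar>prof' a ?s\<bar>"
    using s mult_right_mono[of 1 "1 + ?s" "\<bar>prof' a ?s\<bar>"] by simp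
  then have "\<bar>prof' a ?s\<bar> \<le> 2 * (a + 1) * (a + 2)"
    using prof_bounds(2)[OF assms(1) s] by linarith
  then have "\<bar>z $ i\<bar> * \<bar>prof' a ?s\<bar> \<le> norm z * (2 * (a + 1) * (a + 2))"
    by (intro mult_mono component_le_norm_cart) auto
  then have "(2 * q powr (a + 1)) * (\<bar>z $ i\<bar> * \<bar>prof' a ?s\<bar>) \<le> (2 * q powr (a + 1)) * (norm z * (2 * (a + 1) * (a + 2)))"
    by (intro mult_left_mono) auto
  then show ?thesis by (simp add: ker1_def abs_mult algebra_simps)
qed

text \<open>In contrast to \<open>ker1_bound\<close>, this bound is uniform in \<open>z\<close>, at
  the price of a constant depending on \<open>q\<close>; it serves dominated convergence against an
  integrable \<open>f\<close>.\<close>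

lemma ker1_bounded:
  fixes i :: "'n::finite"
  assumes "a > 0" "q \<ge> 1"
  obtains B where "\<And>z. \<bar>ker1 a q i z\<bar> \<le> B"
proof
  fix z :: "real^'n"
  let ?s = "q * (norm z)\<^sup>2"
  have s: "?s \<ge> 0" using assms by simp
  \<comment> \<open>Expand (|z| - 1)^2 >= 0.\<close>
  have "norm z \<le> 1 + (norm z)\<^sup>2"
    using sum_power2_ge_zero[of "norm z - 1" 0] norm_ge_zero[of z]
    by (simp add: power2_eq_square algebra_simps; linarith)
  also have "\<dots> \<le> 1 + ?s" using assms by (simp add: mult_le_cancel_right1)
  finally have "\<bar>z $ i\<bar> \<le> 1 + ?s" using component_le_norm_cart[of z i] by linarith
  then have "\<bar>z $ i\<bar> * \<bar>prof' a ?s\<bar> \<le> (1 + ?s) * \<bar>prof' a ?s\<bar>"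
    by (intro mult_right_mono) auto
  also have "\<dots> \<le> 2 * (a + 1) * (a + 2)" by (rule prof_bounds(2)[OF assms(1) s])
  finally have "(2 * q powr (a + 1)) * (\<bar>z $ i\<bar> * \<bar>prof' a ?s\<bar>) \<le> (2 * q powr (a + 1)) * (2 * (a + 1) * (a + 2))"
    by (intro mult_left_mono) auto
  then show "\<bar>ker1 a q i z\<bar> \<le> (2 * q powr (a + 1)) * (2 * (a + 1) * (a + 2))"
    by (simp add: ker1_def abs_mult algebra_simps)
qed

lemma ker2_bounded:
  fixes i j :: "'n::finite"
  assumes "a > 0" "q \<ge> 1"
  obtains B where "\<And>z. \<bar>ker2 a q i j z\<bar> \<le> B"
proof
  fix z :: "real^'n"
  let ?s = "q * (norm z)\<^sup>2" and ?C = "2 * (a + 1) * (a + 2)"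
  have s: "?s \<ge> 0" using assms by simp
  have "\<bar>prof' a ?s\<bar> \<le> (1 + ?s) * \<bar>prof' a ?s\<bar>"
    using s mult_right_mono[of 1 "1 + ?s" "\<bar>prof' a ?s\<bar>"] by simp
  then have 1: "\<bar>prof' a ?s\<bar> \<le> ?C"
    using prof_bounds(2)[OF assms(1) s] by linarith
  have "\<bar>z $ i\<bar> * \<bar>z $ j\<bar> \<le> norm z * norm z"
    by (intro mult_mono component_le_norm_cart) auto
  also have "\<dots> \<le> 1 + ?s"
  proof -
    have "1 * (norm z)\<^sup>2 \<le> q * (norm z)\<^sup>2" by (rule mult_right_mono) (use assms in auto)
    then show ?thesis by (simp add: power2_eq_square)
  qed
  finally have "\<bar>z $ i\<bar> * \<bar>z $ j\<bar> * \<bar>prof'' a ?s\<bar> \<le> (1 + ?s) * \<bar>prof'' a ?s\<bar>"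
    by (intro mult_right_mono) auto
  also have "\<dots> \<le> ?C" by (rule prof_bounds(3)[OF assms(1) s])
  finally have 2: "(4 * q powr (a + 2)) * (\<bar>z $ i\<bar> * \<bar>z $ j\<bar> * \<bar>prof'' a ?s\<bar>) \<le> (4 * q powr (a + 2)) * ?C"
    by (intro mult_left_mono) auto
  have 3: "(2 * q powr (a + 1)) * \<bar>prof' a ?s\<bar> \<le> (2 * q powr (a + 1)) * ?C"
    using 1 by (intro mult_left_mono) auto
  have "\<bar>ker2 a q i j z\<bar> \<le> \<bar>4 * (z $ i) * (z $ j) * (q powr (a + 2) * prof'' a ?s)\<bar>
      + \<bar>if i = j then 2 * (q powr (a + 1) * prof' a ?s) else 0\<bar>"
    unfolding ker2_def by (rule abs_triangle_ineq)
  also have "\<dots> \<le> (4 * q powr (a + 2)) * (\<bar>z $ i\<bar> * \<bar>z $ j\<bar> * \<bar>prof'' a ?s\<bar>) + (2 * q powr (a + 1)) * \<bar>prof' a ?s\<bar>"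
    by (auto simp: abs_mult algebra_simps)
  also have "\<dots> \<le> (4 * q powr (a + 2)) * ?C + (2 * q powr (a + 1)) * ?C"
    using 2 3 by linarith
  finally show "\<bar>ker2 a q i j z\<bar> \<le> (4 * q powr (a + 2)) * ?C + (2 * q powr (a + 1)) * ?C" .
qed

lemma ker_scale_eq:
  assumes "q > 0" "q' \<ge> q" "q * (norm z)\<^sup>2 \<ge> 1"
  shows "ker a q' z = ker a q z" "ker1 a q' i z = ker1 a q i z"
proof -
  have "q * (norm z)\<^sup>2 \<le> q' * (norm z)\<^sup>2" using assms by (intro mult_right_mono) auto
  then have 2: "q' > 0" "q' * (norm z)\<^sup>2 \<ge> 1" using assms by auto
  show "ker a q' z = ker a q z" "ker1 a q' i z = ker1 a q i z"
    unfolding ker_def ker1_def prof_scale[OF assms(1,3)] prof_scale[OF 2] by auto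
qed

text \<open>Minus the Laplacian of \<^term>\<open>ker a q\<close>; an approximate identity as \<open>q\<close> grows.\<close>

definition bump :: "real \<Rightarrow> real \<Rightarrow> real^'n \<Rightarrow> real" where
  "bump a q z = q powr (a + 1) * (a * real CARD('n) * (real CARD('n) + 2) * max 0 (1 - q * (norm z)\<^sup>2))"

lemma ker2_trace:
  fixes z :: "real^'n"
  assumes "q > 0" "a = (real CARD('n) - 2) / 2"
  shows "(\<Sum>i\<in>UNIV. ker2 a q i i z) = - bump a q z"
proof -
  let ?s = "q * (norm z)\<^sup>2"
  have sq: "(\<Sum>i\<in>UNIV. z $ i * z $ i) = (norm z)\<^sup>2"
    by (simp add: power2_norm_eq_inner inner_vec_def)
  have pw: "q powr (a + 2) = q powr (a + 1) * q"
    using assms by (simp add: powr_add power2_eq_square)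
  have "(\<Sum>i\<in>UNIV. ker2 a q i i z) =
      4 * (\<Sum>i\<in>UNIV. z $ i * z $ i) * (q powr (a + 2) * prof'' a ?s) + CARD('n) * (2 * (q powr (a + 1) * prof' a ?s))"
    by (simp add: ker2_def sum.distrib sum_distrib_left sum_distrib_right mult.assoc)
  also have "\<dots> = q powr (a + 1) * (4 * ?s * prof'' a ?s + 2 * real CARD('n) * prof' a ?s)"
    unfolding sq pw by (simp add: algebra_simps)
  also have "\<dots> = - bump a q z"
  proof -
    have "?s \<ge> 0" "real CARD('n) = 2 * a + 2" using assms by (auto simp: field_simps)
    note eq = prof_laplace[OF this]
    show ?thesis unfolding eq by (simp add: bump_def)
  qed
  finally show ?thesis .
qed

lemma continuous_bump: "continuous_on UNIV (bump a q)"
  unfolding bump_def[abs_def] by (auto intro!: continuous_intros)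

lemma bump_integrable: "integrable lborel (bump a q :: real^'n \<Rightarrow> real)" if "q \<ge> 1"
proof (rule integrable_compact_support[where r=1])
  show "bump a q z = 0" if "1 < norm z" for z :: "real^'n"
  proof -
    have "1 * 1 \<le> q * (norm z)\<^sup>2" using that \<open>q \<ge> 1\<close> by (intro mult_mono) auto
    then show ?thesis by (simp add: bump_def)
  qed
qed (rule continuous_bump)

text \<open>Scaling by \<open>r\<close> has Jacobian r^n, and (r^2)^(a+1) is the same number because
  2 a + 2 = n. Hence the total mass is the same at every scale, as an approximate identity
  requires.\<close>

lemma bump_integral_scale:
  assumes "r > 0" "a = (real CARD('n) - 2) / 2"
  shows "(LINT z|lborel. bump a (r\<^sup>2) (z::real^'n)) = (LINT z|lborel. bump a 1 (z::real^'n))"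
proof -
  let ?L = "lborel :: (real^'n) measure"
  have [measurable]: "(bump a 1 :: real^'n \<Rightarrow> real) \<in> borel_measurable borel"
    by (rule continuous_imp_borel[OF continuous_bump])
  have pw: "(r\<^sup>2) powr (a + 1) = r ^ CARD('n)"
  proof -
    have "(r\<^sup>2) powr (a + 1) = (r powr 2) powr (a + 1)" using assms(1) by simp
    also have "\<dots> = r powr real CARD('n)" unfolding powr_powr assms(2) by (simp add: field_simps)
    also have "\<dots> = r ^ CARD('n)" by (rule powr_realpow[OF assms(1)])
    finally show ?thesis .
  qed
  have "(LINT z|?L. bump a 1 z) = (LINT z|density (distr lborel borel (\<lambda>x::real^'n. 0 + r *\<^sub>R x)) (\<lambda>_. \<bar>r\<bar>^DIM(real^'n)). bump a 1 z)"
    using lborel_affine[of r "0::real^'n"] assms by simp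
  also have "\<dots> = (LINT z|distr lborel borel (\<lambda>x::real^'n. 0 + r *\<^sub>R x). r ^ CARD('n) * bump a 1 z)"
    using assms
    by (subst integral_density) auto
  also have "\<dots> = (LINT z|lborel. r ^ CARD('n) * bump a 1 (r *\<^sub>R z::real^'n))"
    by (subst integral_distr) auto
  also have "(\<lambda>z::real^'n. r ^ CARD('n) * bump a 1 (r *\<^sub>R z)) = bump a (r\<^sup>2)"
    unfolding bump_def pw by (auto simp: power_mult_distrib)
  finally show ?thesis by simp
qed

lemma bump_nonneg: "a > 0 \<Longrightarrow> bump a q z \<ge> 0"
  unfolding bump_def by (intro mult_nonneg_nonneg) auto

lemma bump_integral_pos:
  assumes "a > 0"
  shows "(LINT z|lborel. bump a 1 (z::real^'n)) > 0"
proof -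
  \<comment> \<open>On the ball of radius 1/2 the factor 1 - |z|^2 is at least 3/4.\<close>
  let ?c = "a * real CARD('n) * (real CARD('n) + 2) * (3/4)"
  have "0 < ?c * measure lborel (cball (0::real^'n) (1/2))"
    using assms content_cball_gt_0_iff[of "0::real^'n" "1/2"] by (intro mult_pos_pos) auto
  also have "\<dots> = (LINT z|lborel. ?c * indicator (cball (0::real^'n) (1/2)) z)"
    by (simp only: integral_mult_right_zero integral_indicator) simp
  also have "\<dots> \<le> (LINT z|lborel. bump a 1 (z::real^'n))"
  proof (rule integral_mono')
    show "integrable lborel (bump a 1 :: real^'n \<Rightarrow> real)" by (rule bump_integrable) simp
    fix z :: "real^'n"
    show "0 \<le> bump a 1 z" by (rule bump_nonneg[OF assms])
    show "?c * indicator (cball 0 (1/2)) z \<le> bump a 1 z"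
    proof (cases "z \<in> cball 0 (1/2)")
      case True
      then have "(norm z)\<^sup>2 \<le> (1/2)\<^sup>2" by (intro power_mono) auto
      then have *: "3/4 \<le> max 0 (1 - 1 * (norm z)\<^sup>2)"
        by (simp only: power2_eq_square)
      have ind: "indicator (cball 0 (1/2)) z = (1::real)" using True by simp
      have "0 \<le> a * real CARD('n) * (real CARD('n) + 2)" using assms by simp
      from mult_left_mono[OF * this] show ?thesis
        unfolding ind bump_def by (simp only: powr_one_eq_one mult_1 mult_1_right)
    next
      case False
      then have "indicator (cball 0 (1/2)) z = (0::real)" by simp
      then show ?thesis using bump_nonneg[OF assms, of 1 z] by simp
    qed
  qed
  finally show ?thesis .
qed

text \<open>The parameter \<open>dim_type\<close> only ties the type \<open>'n\<close>, which does not occur in \<open>a\<close>, to the locale.\<close>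

locale newton =
  fixes a :: real and dim_type :: "'n::finite itself"
  assumes a_eq: "a = (real CARD('n) - 2) / 2" and a_pos: "a > 0"
begin

section \<open>Convolutions with the kernels of parameter 4^m and their increments\<close>

definition vol :: real where
  "vol = measure lborel (cball (0::real^'n) 1)"

lemma vol_nonneg: "vol \<ge> 0"
  by (simp add: vol_def)

definition approx :: "nat \<Rightarrow> (real^'n \<Rightarrow> real) \<Rightarrow> real^'n \<Rightarrow> real" where
  "approx m f = conv (ker a (4 ^ m)) f"

definition approx1 :: "'n \<Rightarrow> nat \<Rightarrow> (real^'n \<Rightarrow> real) \<Rightarrow> real^'n \<Rightarrow> real" where
  "approx1 i m f x = - conv (ker1 a (4 ^ m) i) f x"

definition approx2 :: "'n \<Rightarrow> 'n \<Rightarrow> nat \<Rightarrow> (real^'n \<Rightarrow> real) \<Rightarrow> real^'n \<Rightarrow> real" where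
  "approx2 i j m f = conv (ker2 a (4 ^ m) i j) f"

text \<open>The usual normalisation of the Newtonian kernel, (n - 2) times the area of the unit
  sphere, expressed as a volume integral of minus the Laplacian of the regularised kernel.\<close>

definition mass :: real where
  "mass = (LINT z|lborel. bump a 1 (z::real^'n))"

definition potential :: "(real^'n \<Rightarrow> real) \<Rightarrow> real^'n \<Rightarrow> real" where
  "potential f x = lim (\<lambda>m. approx m f x) / mass"

lemma mass_pos: "mass > 0"
  unfolding mass_def by (rule bump_integral_pos[OF a_pos])

lemma approx_has_partial:
  assumes "integrable lborel f"
  shows "has_partial i (approx m f) (approx1 i m f)"
proof -
  obtain B where B: "\<And>z. \<bar>ker1 a (4 ^ m) i z\<bar> \<le> B"
    using ker1_bounded[OF a_pos, of "4 ^ m" i] by auto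
  have "has_partial i (conv (ker a (4 ^ m)) f) (\<lambda>x. - conv (ker1 a (4 ^ m) i) f x)"
    by (rule conv_has_partial_kernel[OF continuous_ker(1) ker_bound[OF a_pos] continuous_ker(2) B
          ker_has_partial assms]) auto
  then show ?thesis by (simp add: approx_def approx1_def[abs_def])
qed

lemma approx1_has_partial:
  assumes "integrable lborel f"
  shows "has_partial i (approx1 j m f) (approx2 i j m f)"
proof -
  obtain B where B: "\<And>z. \<bar>ker1 a (4 ^ m) j z\<bar> \<le> B"
    using ker1_bounded[OF a_pos, of "4 ^ m" j] by auto
  obtain B' where B': "\<And>z. \<bar>ker2 a (4 ^ m) i j z\<bar> \<le> B'"
    using ker2_bounded[OF a_pos, of "4 ^ m" i j] by auto
  have "has_partial i (conv (ker1 a (4 ^ m) j) f) (\<lambda>x. - conv (ker2 a (4 ^ m) i j) f x)"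
    by (rule conv_has_partial_kernel[OF continuous_ker(2) B continuous_ker(3) B'
          ker1_has_partial assms]) auto
  from has_partial_uminus[OF this] show ?thesis
    by (simp add: approx2_def approx1_def[abs_def])
qed

lemma approx_continuous:
  assumes "integrable lborel f"
  shows "continuous_on UNIV (approx m f)" "continuous_on UNIV (approx1 i m f)"
    "continuous_on UNIV (approx2 i j m f)"
proof -
  obtain B where B: "\<And>z. \<bar>ker1 a (4 ^ m) i z\<bar> \<le> B"
    using ker1_bounded[OF a_pos, of "4 ^ m" i] by auto
  obtain B' where B': "\<And>z. \<bar>ker2 a (4 ^ m) i j z\<bar> \<le> B'"
    using ker2_bounded[OF a_pos, of "4 ^ m" i j] by auto
  show "continuous_on UNIV (approx m f)" unfolding approx_def
    by (rule conv_continuous[OF continuous_ker(1) ker_bound[OF a_pos] assms]) auto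
  show "continuous_on UNIV (approx1 i m f)" unfolding approx1_def[abs_def]
    by (intro continuous_intros conv_continuous[OF continuous_ker(2) B assms])
  show "continuous_on UNIV (approx2 i j m f)" unfolding approx2_def
    by (rule conv_continuous[OF continuous_ker(3) B' assms])
qed

lemma outside_scale:
  assumes "norm z > (1/2) ^ m"
  shows "4 ^ m * (norm z)\<^sup>2 \<ge> 1"
proof -
  have "(4::real) ^ m = 2 ^ m * 2 ^ m" by (simp flip: power_mult_distrib)
  then have "1 = 4 ^ m * ((1/2::real) ^ m)\<^sup>2" by (simp add: power_one_over power2_eq_square)
  also have "\<dots> \<le> 4 ^ m * (norm z)\<^sup>2"
    using assms by (intro mult_left_mono power_mono) auto
  finally show ?thesis .
qed

lemma outside_step:
  assumes "norm z > (1/2) ^ m"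
  shows "ker a (4 ^ Suc m) z - ker a (4 ^ m) z = 0" "ker1 a (4 ^ Suc m) i z - ker1 a (4 ^ m) i z = 0"
    "bump a (4 ^ m) z = 0"
  using ker_scale_eq[of "4 ^ m" "4 ^ Suc m" z, OF _ _ outside_scale[OF assms]] outside_scale[OF assms]
  by (simp_all add: bump_def)

text \<open>Kernel size against volume of the support. By 2 a + 2 = n the exponent \<open>a\<close>
  leaves a gain 4^-m, while a + 1 balances exactly, so that first derivatives decay only through the
  additional factor |z| <= 2^-m.\<close>

lemma scale_powr:
  shows "(4 ^ m) powr a * ((1/2) ^ m) ^ CARD('n) = (1/4 :: real) ^ m"
    and "(4 ^ m) powr (a + 1) * ((1/2) ^ m) ^ CARD('n) = (1 :: real)"
proof -
  have "(4::real) ^ m = 2 ^ m * 2 ^ m" by (simp flip: power_mult_distrib)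
  moreover have "(2::real) powr (real m + real m) = 2 powr m * 2 powr m" by (rule powr_add)
  ultimately have 4: "(4::real) ^ m = 2 powr (2 * m)" by (simp add: powr_realpow)
  have "((1/2::real) ^ m) ^ CARD('n) = 1 / 2 ^ (m * CARD('n))"
    by (simp add: power_one_over power_mult)
  then have half: "((1/2::real) ^ m) ^ CARD('n) = 2 powr (- (real m * CARD('n)))"
    using powr_realpow[of "2::real" "m * CARD('n)"] by (simp add: powr_minus_divide)
  have n: "real CARD('n) = 2 * a + 2" using a_eq by simp
  show *: "(4 ^ m) powr (a + 1) * ((1/2) ^ m) ^ CARD('n) = (1 :: real)"
    unfolding 4 half powr_powr powr_add[symmetric] n by (simp add: algebra_simps)
  show "(4 ^ m) powr a * ((1/2) ^ m) ^ CARD('n) = (1/4 :: real) ^ m"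
    using * by (simp add: powr_add field_simps power_one_over)
qed

lemma conv_local_bound_vol:
  fixes k f :: "real^'n \<Rightarrow> real"
  assumes "\<And>z. norm z \<le> r \<Longrightarrow> \<bar>k z\<bar> \<le> B" "\<And>z. norm z > r \<Longrightarrow> k z = 0"
    and "\<And>y. y \<in> cball x r \<Longrightarrow> \<bar>f y\<bar> \<le> S" and "r \<ge> 0"
  shows "\<bar>conv k f x\<bar> \<le> B * S * (vol * r ^ CARD('n))"
  unfolding vol_def by (rule conv_local_bound[OF assms])

text \<open>Consecutive kernels are of the same order, so the triangle inequality suffices;
  smallness comes from the volume of the support and, for \<open>ker1\<close>, from the
  radius.\<close>

lemma ker_step_bound:
  obtains A where "A \<ge> 0"
    "\<And>m z. \<bar>ker a (4 ^ Suc m) (z::real^'n) - ker a (4 ^ m) z\<bar> \<le> A * (4 ^ m) powr a"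
    "\<And>m i z. norm z \<le> (1/2) ^ m \<Longrightarrow>
       \<bar>ker1 a (4 ^ Suc m) i (z::real^'n) - ker1 a (4 ^ m) i z\<bar> \<le> A * (4 ^ m) powr (a + 1) * (1/2) ^ m"
proof
  \<comment> \<open>With C = 2 (a+1) (a+2), the kernels need C (4^a + 1) and their derivatives 2 C
    (4^(a+1) + 1); the latter covers both.\<close>
  define A where "A = 2 * (a + 1) * (a + 2) * (2 * (4 powr (a + 1) + 1))"
  show A: "A \<ge> 0" unfolding A_def using a_pos by (intro mult_nonneg_nonneg add_nonneg_nonneg) auto
  have pw: "(4 ^ Suc m) powr b = 4 powr b * (4 ^ m) powr b" for m and b :: real
    by (simp add: powr_mult)
  fix m :: nat and z :: "real^'n"
  let ?q = "4 ^ m :: real"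
  let ?C = "2 * (a + 1) * (a + 2)"
  have C: "?C \<ge> 0" using a_pos by (intro mult_nonneg_nonneg) auto
  have "\<bar>ker a (4 ^ Suc m) z - ker a ?q z\<bar> \<le> ?C * (4 ^ Suc m) powr a + ?C * ?q powr a"
    using ker_bound[OF a_pos, of "4 ^ Suc m" z] ker_bound[OF a_pos, of ?q z] by (simp add: abs_le_iff)
  also have "\<dots> = ?C * (4 powr a + 1) * ?q powr a" unfolding pw by (simp add: algebra_simps)
  also have "\<dots> \<le> A * ?q powr a"
  proof (rule mult_right_mono)
    have "4 powr a \<le> 4 powr (a + 1)" by (rule powr_mono) auto
    moreover have "p + 1 \<le> 2 * (P + 1)" if "p \<le> P" "0 \<le> P" for p P :: real
      using that by simp
    ultimately have "4 powr a + 1 \<le> 2 * (4 powr (a + 1) + 1)"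
      using powr_ge_zero by blast
    from mult_left_mono[OF this C] show "?C * (4 powr a + 1) \<le> A" by (simp only: A_def)
  qed simp
  finally show "\<bar>ker a (4 ^ Suc m) z - ker a ?q z\<bar> \<le> A * ?q powr a" .
  fix i assume z: "norm z \<le> (1/2) ^ m"
  have "\<bar>ker1 a (4 ^ Suc m) i z - ker1 a ?q i z\<bar> \<le>
     4 * (a + 1) * (a + 2) * (4 ^ Suc m) powr (a + 1) * norm z + 4 * (a + 1) * (a + 2) * ?q powr (a + 1) * norm z"
    using ker1_bound[OF a_pos, of "4 ^ Suc m" i z] ker1_bound[OF a_pos, of ?q i z]
    by (simp add: abs_le_iff)
  also have "\<dots> = A * ?q powr (a + 1) * norm z"
    unfolding pw A_def by (simp add: algebra_simps)
  also have "\<dots> \<le> A * ?q powr (a + 1) * (1/2) ^ m"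
    using A z by (intro mult_left_mono) auto
  finally show "\<bar>ker1 a (4 ^ Suc m) i z - ker1 a ?q i z\<bar> \<le> A * ?q powr (a + 1) * (1/2) ^ m" .
qed

text \<open>The choice operator names one admissible constant for the whole locale, so that later
  bounds can mention it explicitly.\<close>

definition step_const :: real where
  "step_const = (SOME A. A \<ge> 0 \<and>
    (\<forall>m z. \<bar>ker a (4 ^ Suc m) (z::real^'n) - ker a (4 ^ m) z\<bar> \<le> A * (4 ^ m) powr a) \<and>
    (\<forall>m i z. norm z \<le> (1/2) ^ m \<longrightarrow>
       \<bar>ker1 a (4 ^ Suc m) i (z::real^'n) - ker1 a (4 ^ m) i z\<bar> \<le> A * (4 ^ m) powr (a + 1) * (1/2) ^ m))"

lemma step_const:
  "step_const \<ge> 0"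
  "\<bar>ker a (4 ^ Suc m) (z::real^'n) - ker a (4 ^ m) z\<bar> \<le> step_const * (4 ^ m) powr a"
  "norm z \<le> (1/2) ^ m \<Longrightarrow>
     \<bar>ker1 a (4 ^ Suc m) i (z::real^'n) - ker1 a (4 ^ m) i z\<bar> \<le> step_const * (4 ^ m) powr (a + 1) * (1/2) ^ m"
proof -
  have "\<exists>A. A \<ge> 0 \<and>
    (\<forall>m z. \<bar>ker a (4 ^ Suc m) (z::real^'n) - ker a (4 ^ m) z\<bar> \<le> A * (4 ^ m) powr a) \<and>
    (\<forall>m i z. norm z \<le> (1/2) ^ m \<longrightarrow>
       \<bar>ker1 a (4 ^ Suc m) i (z::real^'n) - ker1 a (4 ^ m) i z\<bar> \<le> A * (4 ^ m) powr (a + 1) * (1/2) ^ m)"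
    by (rule ker_step_bound) (rule exI, intro conjI allI impI; assumption)
  note * = someI_ex[OF this, folded step_const_def]
  show "step_const \<ge> 0"
    "\<bar>ker a (4 ^ Suc m) (z::real^'n) - ker a (4 ^ m) z\<bar> \<le> step_const * (4 ^ m) powr a"
    "norm z \<le> (1/2) ^ m \<Longrightarrow>
     \<bar>ker1 a (4 ^ Suc m) i (z::real^'n) - ker1 a (4 ^ m) i z\<bar> \<le> step_const * (4 ^ m) powr (a + 1) * (1/2) ^ m"
    using * by simp_all
qed

lemma half_power_ball: "y \<in> cball x ((1/2) ^ m) \<Longrightarrow> y \<in> cball x (1::real)"
  using power_le_one[of "1/2::real" m] by (simp only: mem_cball) (erule order_trans, simp)

lemma conv_ker1_step_bound:
  fixes f :: "real^'n \<Rightarrow> real"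
  assumes "\<And>y. y \<in> cball x 1 \<Longrightarrow> \<bar>f y\<bar> \<le> S"
  shows "\<bar>conv (\<lambda>z. ker1 a (4 ^ Suc m) i z - ker1 a (4 ^ m) i z) f x\<bar> \<le> step_const * vol * S * (1/2) ^ m"
proof -
  have "\<bar>conv (\<lambda>z. ker1 a (4 ^ Suc m) i z - ker1 a (4 ^ m) i z) f x\<bar>
      \<le> (step_const * (4 ^ m) powr (a + 1) * (1/2) ^ m) * S * (vol * ((1/2) ^ m) ^ CARD('n))"
    by (rule conv_local_bound_vol) (use assms half_power_ball step_const(3) outside_step(2) in auto)
  also have "\<dots> = step_const * vol * S * (1/2) ^ m * ((4 ^ m) powr (a + 1) * ((1/2) ^ m) ^ CARD('n))"
    by (simp only: mult_ac)
  finally show ?thesis unfolding scale_powr by simp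
qed

lemma approx_step_bound:
  assumes f: "integrable lborel f" and S: "\<And>y. y \<in> cball x 1 \<Longrightarrow> \<bar>f y\<bar> \<le> S"
  shows "\<bar>approx (Suc m) f x - approx m f x\<bar> \<le> step_const * vol * S * (1/4) ^ m"
proof -
  have "approx (Suc m) f x - approx m f x = conv (\<lambda>z. ker a (4 ^ Suc m) z - ker a (4 ^ m) z) f x"
    unfolding approx_def
    by (rule conv_diff_kernel[OF continuous_ker(1) ker_bound[OF a_pos] continuous_ker(1) ker_bound[OF a_pos] f, symmetric]) auto
  also have "\<bar>\<dots>\<bar> \<le> (step_const * (4 ^ m) powr a) * S * (vol * ((1/2) ^ m) ^ CARD('n))"
    by (rule conv_local_bound_vol) (use S half_power_ball step_const(2) outside_step(1) in auto)
  also have "\<dots> = step_const * vol * S * ((4 ^ m) powr a * ((1/2) ^ m) ^ CARD('n))"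
    by (simp only: mult_ac)
  finally show ?thesis unfolding scale_powr .
qed

lemma approx1_diff:
  assumes f: "integrable lborel f"
  shows "approx1 i (Suc m) f x - approx1 i m f x = - conv (\<lambda>z. ker1 a (4 ^ Suc m) i z - ker1 a (4 ^ m) i z) f x"
proof -
  obtain B where B: "\<And>z. \<bar>ker1 a (4 ^ m) i z\<bar> \<le> B"
    using ker1_bounded[OF a_pos, of "4 ^ m" i] by auto
  obtain B' where B': "\<And>z. \<bar>ker1 a (4 ^ Suc m) i z\<bar> \<le> B'"
    using ker1_bounded[OF a_pos one_le_power[of 4 "Suc m"], of i] by (meson one_le_numeral)
  show ?thesis
    using conv_diff_kernel[OF continuous_ker(2) B' continuous_ker(2) B f, of x] by (simp add: approx1_def)
qed

lemma approx1_step_bound: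
  assumes f: "integrable lborel f" and S: "\<And>y. y \<in> cball x 1 \<Longrightarrow> \<bar>f y\<bar> \<le> S"
  shows "\<bar>approx1 i (Suc m) f x - approx1 i m f x\<bar> \<le> step_const * vol * S * (1/2) ^ m"
  unfolding approx1_diff[OF f] abs_minus_cancel by (rule conv_ker1_step_bound[OF S])

text \<open>The kernel increments have compact support, so one of the two derivatives may be moved
  from the kernel to the function.\<close>

lemma approx2_diff:
  assumes f: "integrable lborel f" "continuous_on UNIV f"
    and D: "has_partial i f f'" "continuous_on UNIV f'"
  shows "approx2 i j (Suc m) f x - approx2 i j m f x =
     - conv (\<lambda>z. ker1 a (4 ^ Suc m) j z - ker1 a (4 ^ m) j z) f' x"
proof -
  let ?k = "\<lambda>z. ker1 a (4 ^ Suc m) j z - ker1 a (4 ^ m) j z"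
  have "has_partial i (conv ?k f) (conv ?k f')"
    by (rule conv_has_partial_function[where r="(1/2) ^ m"])
       (use f D outside_step in \<open>auto intro!: continuous_intros continuous_ker\<close>)
  from has_partial_uminus[OF this]
  have "has_partial i (\<lambda>x. approx1 j (Suc m) f x - approx1 j m f x) (\<lambda>x. - conv ?k f' x)"
    unfolding approx1_diff[OF f(1)] .
  moreover have "has_partial i (\<lambda>x. approx1 j (Suc m) f x - approx1 j m f x)
      (\<lambda>x. approx2 i j (Suc m) f x - approx2 i j m f x)"
    by (intro has_partial_diff approx1_has_partial f)
  \<comment> \<open>Both sides are partial derivatives of the same function; their equality is the
    integration by parts.\<close>
  ultimately have "(\<lambda>x. approx2 i j (Suc m) f x - approx2 i j m f x) = (\<lambda>x. - conv ?k f' x)"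
    using has_partial_unique by blast
  then show ?thesis by (rule fun_cong)
qed

lemma local_bound_const:
  fixes f :: "real^'n \<Rightarrow> real"
  assumes "continuous_on UNIV f"
  obtains S where "S \<ge> 0" "\<And>x y. x \<in> cball 0 R \<Longrightarrow> y \<in> cball x 1 \<Longrightarrow> \<bar>f y\<bar> \<le> S"
proof -
  obtain S where S: "\<And>y. y \<in> cball 0 (R + 1) \<Longrightarrow> \<bar>f y\<bar> \<le> S"
    using continuous_bounded_on_cball[OF assms] by blast
  \<comment> \<open>The absolute value ensures nonnegativity also when \<open>R\<close> is so
    negative that the balls are empty.\<close>
  show thesis
  proof (rule that[of "\<bar>S\<bar>"])
    fix x y :: "real^'n" assume "x \<in> cball 0 R" "y \<in> cball x 1"
    then have "y \<in> cball 0 (R + 1)"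
      using dist_triangle[of 0 y x] by simp
    from S[OF this] show "\<bar>f y\<bar> \<le> \<bar>S\<bar>" by linarith
  qed simp
qed

lemma approx_loc_geometric:
  assumes f: "integrable lborel f" "continuous_on UNIV f"
  shows "loc_geometric (\<lambda>m. approx m f)" and "loc_geometric (\<lambda>m. approx1 i m f)"
proof -
  show "loc_geometric (\<lambda>m. approx1 i m f)"
    unfolding loc_geometric_def
  proof
    fix R :: real
    obtain S where S: "\<And>x y. x \<in> cball 0 R \<Longrightarrow> y \<in> cball x 1 \<Longrightarrow> \<bar>f y\<bar> \<le> S"
      using local_bound_const[OF f(2)] by metis
    show "\<exists>A. \<forall>m. \<forall>x\<in>cball 0 R. \<bar>approx1 i (Suc m) f x - approx1 i m f x\<bar> \<le> A * (1/2) ^ m"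
      using approx1_step_bound[OF f(1)] S by blast
  qed
  show "loc_geometric (\<lambda>m. approx m f)"
    unfolding loc_geometric_def
  proof
    fix R :: real
    obtain S where S: "S \<ge> 0" "\<And>x y. x \<in> cball 0 R \<Longrightarrow> y \<in> cball x 1 \<Longrightarrow> \<bar>f y\<bar> \<le> S"
      using local_bound_const[OF f(2)] by metis
    have "\<bar>approx (Suc m) f x - approx m f x\<bar> \<le> (step_const * vol * S) * (1/2) ^ m" if "x \<in> cball 0 R" for m x
    proof -
      have "step_const * vol * S * (1/4) ^ m \<le> step_const * vol * S * (1/2) ^ m"
        using step_const(1) S(1) vol_nonneg by (intro mult_left_mono power_mono) auto
      moreover have "\<bar>approx (Suc m) f x - approx m f x\<bar> \<le> step_const * vol * S * (1/4) ^ m"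
        by (rule approx_step_bound[OF f(1)]) (rule S(2)[OF that])
      ultimately show ?thesis by linarith
    qed
    then show "\<exists>A. \<forall>m. \<forall>x\<in>cball 0 R. \<bar>approx (Suc m) f x - approx m f x\<bar> \<le> A * (1/2) ^ m"
      by blast
  qed
qed

text \<open>After the transfer to \<open>f'\<close> only increments of \<open>ker1\<close> remain,
  so the rate is that of the first derivatives, with \<open>f'\<close> in the place of
  \<open>f\<close>.\<close>

lemma approx2_loc_geometric:
  assumes f: "integrable lborel f" "continuous_on UNIV f"
    and D: "has_partial i f f'" "continuous_on UNIV f'"
  shows "loc_geometric (\<lambda>m. approx2 i j m f)"
  unfolding loc_geometric_def
proof
  fix R :: real
  obtain S where S: "\<And>x y. x \<in> cball 0 R \<Longrightarrow> y \<in> cball x 1 \<Longrightarrow> \<bar>f' y\<bar> \<le> S"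
    using local_bound_const[OF D(2)] by metis
  show "\<exists>A. \<forall>m. \<forall>x\<in>cball 0 R. \<bar>approx2 i j (Suc m) f x - approx2 i j m f x\<bar> \<le> A * (1/2) ^ m"
    unfolding approx2_diff[OF f D] abs_minus_cancel using conv_ker1_step_bound S by blast
qed

lemma bump_conv_tendsto:
  fixes f :: "real^'n \<Rightarrow> real"
  assumes f: "continuous_on UNIV f"
  shows "(\<lambda>m. conv (bump a (4 ^ m)) f x) \<longlonglongrightarrow> mass * f x"
proof -
  define A where "A = a * real CARD('n) * (real CARD('n) + 2)"
  have A: "A \<ge> 0" unfolding A_def using a_pos by (intro mult_nonneg_nonneg) auto
  have bump_le: "\<bar>bump a (4 ^ m) z\<bar> \<le> A * (4 ^ m) powr (a + 1)" for m and z :: "real^'n"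
  proof -
    have "A * max 0 (1 - 4 ^ m * (norm z)\<^sup>2) \<le> A" using A by (intro mult_left_le) auto
    then have "(4 ^ m) powr (a + 1) * (A * max 0 (1 - 4 ^ m * (norm z)\<^sup>2)) \<le> (4 ^ m) powr (a + 1) * A"
      by (rule mult_left_mono) simp
    then show ?thesis using bump_nonneg[OF a_pos, of "4 ^ m" z] by (simp add: bump_def A_def mult.commute)
  qed
  have mass_eq: "(LINT z|lborel. bump a (4 ^ m) (z::real^'n)) = mass" for m
  proof -
    have "(4::real) ^ m = (2 ^ m)\<^sup>2" by (simp add: power2_eq_square flip: power_mult_distrib)
    then show ?thesis unfolding mass_def by (simp only:) (rule bump_integral_scale[OF _ a_eq], simp)
  qed
  \<comment> \<open>The mass is constant and the support has radius 2^-m, so the error is controlled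
    by the oscillation of \<open>f\<close> on that ball; the size of the bump and the volume of the
    ball cancel.\<close>
  have osc: "\<bar>conv (bump a (4 ^ m)) f x - mass * f x\<bar> \<le> A * vol * e"
    if e: "\<And>y. y \<in> cball x ((1/2) ^ m) \<Longrightarrow> \<bar>f y - f x\<bar> \<le> e" for m e
  proof -
    let ?b = "bump a (4 ^ m) :: real^'n \<Rightarrow> real"
    note [measurable] = continuous_imp_borel[OF f] continuous_imp_borel[OF continuous_bump, of a "4 ^ m"]
    have int: "integrable lborel (\<lambda>z. ?b z * f (x + z))"
      by (rule integrable_compact_support[where r="(1/2) ^ m"])
        (auto simp: outside_step(3) intro!: continuous_intros continuous_bump continuous_on_compose2[OF f])
    have "conv ?b (\<lambda>y. f y - f x) x = (LINT z|lborel. ?b z * f (x + z) - ?b z * f x)"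
      by (subst conv_translate) (auto simp: algebra_simps)
    also have "\<dots> = (LINT z|lborel. ?b z * f (x + z)) - mass * f x"
      using int bump_integrable[of "4 ^ m" a, where 'n='n] by (simp add: mass_eq)
    also have "(LINT z|lborel. ?b z * f (x + z)) = conv ?b f x"
      by (rule conv_translate[symmetric]) auto
    finally have "\<bar>conv ?b f x - mass * f x\<bar> = \<bar>conv ?b (\<lambda>y. f y - f x) x\<bar>" by simp
    also have "\<dots> \<le> (A * (4 ^ m) powr (a + 1)) * e * (vol * ((1/2) ^ m) ^ CARD('n))"
      by (rule conv_local_bound_vol) (use e bump_le outside_step(3) in auto)
    also have "\<dots> = A * vol * e * ((4 ^ m) powr (a + 1) * ((1/2) ^ m) ^ CARD('n))"
      by (simp only: mult_ac)
    finally show ?thesis unfolding scale_powr by simp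
  qed
  show ?thesis
  proof (rule LIMSEQ_I)
    fix r :: real assume r: "r > 0"
    \<comment> \<open>The summand 1 keeps the denominator positive even if \<open>A * vol\<close>
      vanishes and makes the final inequality strict.\<close>
    define e where "e = r / (A * vol + 1)"
    have v: "A * vol \<ge> 0" using A vol_nonneg by simp
    then have e: "e > 0" using r by (simp add: e_def)
    have "isCont f x" using f by (simp add: continuous_on_eq_continuous_at)
    then obtain d where d: "d > 0" "\<And>y. dist y x < d \<Longrightarrow> dist (f y) (f x) < e"
      using e unfolding continuous_at_eps_delta by blast
    obtain N where N: "(1/2::real) ^ N < d" using real_arch_pow_inv[OF d(1), of "1/2"] by auto
    show "\<exists>no. \<forall>n\<ge>no. norm (conv (bump a (4 ^ n)) f x - mass * f x) < r"
    proof (intro exI allI impI)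
      fix n assume "N \<le> n"
      then have le: "(1/2::real) ^ n \<le> (1/2) ^ N" by (intro power_decreasing) auto
      have "\<bar>f y - f x\<bar> \<le> e" if "y \<in> cball x ((1/2) ^ n)" for y
      proof -
        have "dist y x < d" using that le N by (simp only: mem_cball dist_commute)
        from d(2)[OF this] show ?thesis by (simp add: dist_real_def)
      qed
      then have "\<bar>conv (bump a (4 ^ n)) f x - mass * f x\<bar> \<le> A * vol * e" by (rule osc)
      also have "\<dots> < (A * vol + 1) * e" using e by simp
      also have "\<dots> = r" using v by (simp add: e_def)
      finally show "norm (conv (bump a (4 ^ n)) f x - mass * f x) < r" by simp
    qed
  qed
qed

lemma approx2_trace:
  assumes f: "integrable lborel f"
  shows "(\<Sum>i\<in>UNIV. approx2 i i m f x) = - conv (bump a (4 ^ m)) f x"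
proof -
  have int: "integrable lborel (\<lambda>y. ker2 a (4 ^ m) i i (y - x) * f y)" for i
  proof -
    obtain B where B: "\<And>z. \<bar>ker2 a (4 ^ m) i i z\<bar> \<le> B"
      using ker2_bounded[OF a_pos, of "4 ^ m" i i] by auto
    show ?thesis
      by (rule integrable_bounded_mult[OF continuous_imp_borel[OF continuous_ker(3)] f B])
  qed
  have "(\<Sum>i\<in>UNIV. approx2 i i m f x) = (LINT y|lborel. (\<Sum>i\<in>UNIV. ker2 a (4 ^ m) i i (y - x) * f y))"
    unfolding approx2_def conv_def using int by (subst Bochner_Integration.integral_sum) auto
  also have "\<dots> = (LINT y|lborel. - (bump a (4 ^ m) (y - x) * f y))"
    by (simp add: sum_distrib_right[symmetric] ker2_trace a_eq)
  finally show ?thesis by (simp add: conv_def)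
qed

end

section \<open>Maximum principle and behaviour at infinity\<close>

text \<open>If c < 0, then g' < 0 just to the right of the critical point 0, and the mean value
  theorem gives a smaller value of \<open>g\<close> there.\<close>

lemma second_derivative_at_local_min:
  fixes g :: "real \<Rightarrow> real"
  assumes d: "d > 0" and g: "\<And>t. (g has_real_derivative g' t) (at t)"
    and g': "(g' has_real_derivative c) (at 0)" and min: "\<And>t. \<bar>t\<bar> < d \<Longrightarrow> g 0 \<le> g t"
  shows "c \<ge> 0"
proof (rule ccontr)
  assume c: "\<not> c \<ge> 0"
  have "g' 0 = 0"
    by (rule DERIV_local_min[OF g d]) (use min in auto)
  moreover obtain d' where d': "d' > 0" "\<And>h. 0 < h \<Longrightarrow> h < d' \<Longrightarrow> g' (0 + h) < g' 0"
    using DERIV_neg_dec_right[OF g'] c by auto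
  ultimately have neg: "g' z < 0" if "0 < z" "z < d'" for z using that by force
  define h where "h = min d d' / 2"
  have h: "0 < h" "h < d" "h < d'" using d d' by (auto simp: h_def min_def)
  obtain z where z: "0 < z" "z < h" "g h - g 0 = (h - 0) * g' z"
    using MVT2[OF h(1), of g g'] g by auto
  have "h * g' z < 0" using h z neg[of z] by (simp add: mult_pos_neg)
  then show False using z min[of h] h by simp
qed

text \<open>If \<open>v\<close> fell below \<open>L\<close> by \<delta> at \<open>x0\<close>,
  subtracting a small multiple of |x|^2 would make it strictly superharmonic while keeping the
  minimum over a large ball in the interior, where all pure second derivatives are
  nonnegative.\<close>

lemma superharmonic_ge_limit:
  fixes v :: "real^'n \<Rightarrow> real"
  assumes cont: "continuous_on UNIV v" and D: "\<And>i. has_partial i v (D i)"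
    and E: "\<And>i. has_partial i (D i) (E i)" and super: "\<And>x. (\<Sum>i\<in>UNIV. E i x) \<le> 0"
    and lim: "(v \<longlongrightarrow> L) at_infinity"
  shows "v x0 \<ge> L"
proof (rule ccontr)
  assume "\<not> v x0 \<ge> L"
  then have "L - v x0 > 0" by simp
  define \<delta> where "\<delta> = L - v x0"
  have \<delta>: "\<delta> > 0" using \<open>L - v x0 > 0\<close> by (simp add: \<delta>_def)
  have "\<forall>\<^sub>F x in at_infinity. v x > L - \<delta> / 4"
    using order_tendstoD(1)[OF lim] \<delta> by simp
  then obtain b where b: "\<And>x. norm x \<ge> b \<Longrightarrow> v x > L - \<delta> / 4"
    unfolding eventually_at_infinity by auto
  define R where "R = max b (norm x0 + 1)"
  have R: "R \<ge> b" "R > 0" "norm x0 < R" 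
    using norm_ge_zero[of x0] unfolding R_def by linarith+
  \<comment> \<open>The perturbation costs at most \<delta>/4 on the ball: on its boundary
    \<open>p\<close> exceeds L - \<delta>/2, whereas p x0 <= L - \<delta>.\<close>
  define \<epsilon> where "\<epsilon> = \<delta> / (4 * R\<^sup>2)"
  have \<epsilon>: "\<epsilon> > 0" "\<epsilon> * R\<^sup>2 = \<delta> / 4" using \<delta> R by (auto simp: \<epsilon>_def)
  define p where "p x = v x - \<epsilon> * (norm x)\<^sup>2" for x
  have "continuous_on (cball 0 R) p"
    unfolding p_def by (intro continuous_intros continuous_on_subset[OF cont]) auto
  then obtain y where y: "y \<in> cball 0 R" "\<And>x. x \<in> cball 0 R \<Longrightarrow> p y \<le> p x"
    using continuous_attains_inf[of "cball 0 R" p] R by auto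
  have "p y \<le> p x0" using y(2)[of x0] R by simp
  also have "\<dots> \<le> L - \<delta>" using \<epsilon> by (simp add: p_def \<delta>_def)
  finally have py: "p y \<le> L - \<delta>" .
  have "norm y < R"
  proof (rule ccontr)
    assume "\<not> norm y < R"
    then have n: "norm y = R" using y(1) by simp
    then have "p y > L - \<delta> / 4 - \<delta> / 4" using b[of y] R \<epsilon> by (simp add: p_def)
    then show False using py \<delta> by simp
  qed
  have "E i y - 2 * \<epsilon> \<ge> 0" for i
  proof (rule second_derivative_at_local_min)
    show "R - norm y > 0" using \<open>norm y < R\<close> by simp
    have 1: "((\<lambda>t. \<epsilon> * ((norm y)\<^sup>2 + 2 * t * y $ i + t\<^sup>2)) has_real_derivative \<epsilon> * (2 * y $ i + 2 * t)) (at t)" for t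
      by (rule derivative_eq_intros refl | simp)+
    show "((\<lambda>t. p (y + t *\<^sub>R axis i 1)) has_real_derivative
       D i (y + t *\<^sub>R axis i 1) - \<epsilon> * (2 * y $ i + 2 * t)) (at t)" for t
      unfolding p_def norm_add_axis_sq by (rule DERIV_diff[OF has_partialD[OF D] 1])
    have 2: "((\<lambda>t. \<epsilon> * (2 * y $ i + 2 * t)) has_real_derivative 2 * \<epsilon>) (at 0)"
      by (rule derivative_eq_intros refl | simp)+
    have "((\<lambda>t. D i (y + t *\<^sub>R axis i 1)) has_real_derivative E i y) (at 0)"
      using has_partialD[OF E, of i y 0] by simp
    then show "((\<lambda>t. D i (y + t *\<^sub>R axis i 1) - \<epsilon> * (2 * y $ i + 2 * t)) has_real_derivative E i y - 2 * \<epsilon>) (at 0)"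
      by (rule DERIV_diff[OF _ 2])
    fix t :: real assume "\<bar>t\<bar> < R - norm y"
    then have "y + t *\<^sub>R axis i 1 \<in> cball 0 R"
      using norm_triangle_ineq[of y "t *\<^sub>R axis i 1"] by (simp add: norm_axis_1)
    then show "p (y + 0 *\<^sub>R axis i 1) \<le> p (y + t *\<^sub>R axis i 1)" using y(2) by simp
  qed
  then have "2 * \<epsilon> \<le> E i y" for i by simp
  then have "(\<Sum>i\<in>(UNIV::'n set). 2 * \<epsilon>) \<le> (\<Sum>i\<in>UNIV. E i y)" by (intro sum_mono)
  moreover have "(\<Sum>i\<in>(UNIV::'n set). 2 * \<epsilon>) > 0" using \<epsilon> by simp
  ultimately show False using super[of y] by linarith
qed

text \<open>Dominated convergence is applied along sequences; this transfers its conclusion to the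
  filter at infinity.\<close>

lemma tendsto_at_infinity_sequentially:
  fixes f :: "'a::real_normed_vector \<Rightarrow> real"
  assumes "\<And>X. filterlim X at_infinity sequentially \<Longrightarrow> (\<lambda>n. f (X n)) \<longlonglongrightarrow> L"
  shows "(f \<longlongrightarrow> L) at_infinity"
proof (rule tendstoI, rule ccontr)
  fix e :: real assume e: "e > 0" "\<not> (\<forall>\<^sub>F x in at_infinity. dist (f x) L < e)"
  then have "\<forall>n::nat. \<exists>x. norm x \<ge> real n \<and> dist (f x) L \<ge> e"
    unfolding eventually_at_infinity by (meson not_less)
  then obtain X where X: "\<And>n::nat. norm (X n) \<ge> real n" "\<And>n. dist (f (X n)) L \<ge> e"
    by metis
  have "filterlim X at_infinity sequentially"
    unfolding filterlim_at_infinity_conv_norm_at_top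
    by (rule filterlim_at_top_mono[OF filterlim_real_sequentially]) (use X in auto)
  then have "\<forall>\<^sub>F n in sequentially. dist (f (X n)) L < e"
    using assms e by (intro tendstoD) auto
  then show False using X(2) by (auto simp: eventually_sequentially not_less[symmetric])
qed

lemma ker_at_infinity:
  assumes "a > 0"
  shows "(ker a 1 \<longlongrightarrow> 0) (at_infinity :: (real^'n) filter)"
proof (rule Lim_transform_eventually)
  have "filterlim (\<lambda>z::real^'n. (norm z)\<^sup>2) at_top at_infinity"
    by (rule filterlim_pow_at_top[OF _ filterlim_norm_at_top]) simp
  then show "((\<lambda>z::real^'n. (norm z)\<^sup>2 powr (- a)) \<longlongrightarrow> 0) at_infinity"
    using assms by (intro tendsto_neg_powr) auto
  show "\<forall>\<^sub>F z in at_infinity. (norm z)\<^sup>2 powr (- a) = ker a 1 (z::real^'n)"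
    unfolding eventually_at_infinity
  proof (intro exI allI impI)
    fix z :: "real^'n" assume "1 \<le> norm z"
    then have "1 \<le> 1 * (norm z)\<^sup>2" by simp
    from prof_scale(1)[OF _ this, of a] show "(norm z)\<^sup>2 powr (- a) = ker a 1 z"
      by (simp add: ker_def)
  qed
qed

text \<open>For fixed \<open>y\<close> the argument y - X n leaves every bounded set, so the
  integrand tends to 0 pointwise under the majorant B |f|.\<close>

lemma conv_at_infinity:
  fixes k f :: "real^'n \<Rightarrow> real"
  assumes k: "continuous_on UNIV k" "\<And>z. \<bar>k z\<bar> \<le> B" "(k \<longlongrightarrow> 0) at_infinity" and f: "integrable lborel f"
  shows "(conv k f \<longlongrightarrow> 0) at_infinity"
proof (rule tendsto_at_infinity_sequentially)
  fix X :: "nat \<Rightarrow> real^'n" assume X: "filterlim X at_infinity sequentially"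
  note [measurable] = continuous_imp_borel[OF k(1)] integrable_imp_borel[OF f]
  have "(\<lambda>n. LINT y|lborel. k (y - X n) * f y) \<longlonglongrightarrow> (LINT y|(lborel :: (real^'n) measure). 0)"
  proof (rule integral_dominated_convergence[where w = "\<lambda>y. B * \<bar>f y\<bar>"])
    show "AE y in lborel. (\<lambda>n. k (y - X n) * f y) \<longlonglongrightarrow> 0"
    proof (intro AE_I2 tendsto_mult_left_zero)
      fix y
      have "filterlim (\<lambda>n. - X n) at_infinity sequentially"
        using X by (simp add: filterlim_at_infinity_conv_norm_at_top)
      then have "filterlim (\<lambda>n. y + - X n) at_infinity sequentially"
        by (intro tendsto_add_filterlim_at_infinity[OF tendsto_const])
      from filterlim_compose[OF k(3) this] show "(\<lambda>n. k (y - X n)) \<longlonglongrightarrow> 0" by simp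
    qed
    show "AE y in lborel. norm (k (y - X n) * f y) \<le> B * \<bar>f y\<bar>" for n
      by (intro AE_I2) (auto simp: abs_mult intro!: mult_right_mono k)
  qed (use f in auto)
  then show "(\<lambda>n. conv k f (X n)) \<longlonglongrightarrow> 0" by (simp add: conv_def)
qed

section \<open>The Newtonian potential\<close>

context newton
begin

definition potential1 :: "'n \<Rightarrow> (real^'n \<Rightarrow> real) \<Rightarrow> real^'n \<Rightarrow> real" where
  "potential1 i f x = lim (\<lambda>m. approx1 i m f x) / mass"

definition potential2 :: "'n \<Rightarrow> 'n \<Rightarrow> (real^'n \<Rightarrow> real) \<Rightarrow> real^'n \<Rightarrow> real" where
  "potential2 i j f x = lim (\<lambda>m. approx2 i j m f x) / mass"

text \<open>One derivative requires only a continuous \<open>f\<close>, which is what a uniform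
  limit of continuous iterates offers. The gain of a derivative starts the regularity
  bootstrap.\<close>

lemma potential_C1:
  assumes f: "integrable lborel f" "continuous_on UNIV f"
  shows "continuous_on UNIV (potential f)" "continuous_on UNIV (potential1 i f)"
    and "has_partial i (potential f) (potential1 i f)"
proof -
  note g = approx_loc_geometric[OF f]
  show "continuous_on UNIV (potential f)" "continuous_on UNIV (potential1 i f)"
    unfolding potential_def[abs_def] potential1_def[abs_def]
    using mass_pos by (auto intro!: continuous_intros loc_geometric_continuous g approx_continuous f)
  show "has_partial i (potential f) (potential1 i f)"
    unfolding potential_def[abs_def] potential1_def[abs_def]
    by (intro has_partial_divide loc_geometric_has_partial g approx_has_partial f)
qed

lemma potential_C2:
  assumes f: "integrable lborel f" "continuous_on UNIV f"
    and D: "\<And>i. has_partial i f (f' i)" "\<And>i. continuous_on UNIV (f' i)"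
  shows "continuous_on UNIV (potential2 i j f)"
    and "has_partial i (potential1 j f) (potential2 i j f)"
    and "(\<Sum>i\<in>UNIV. potential2 i i f x) = - f x"
proof -
  note g = approx_loc_geometric[OF f] and g2 = approx2_loc_geometric[OF f D]
  show "continuous_on UNIV (potential2 i j f)"
    unfolding potential2_def[abs_def]
    using mass_pos by (auto intro!: continuous_intros loc_geometric_continuous g2 approx_continuous f)
  show "has_partial i (potential1 j f) (potential2 i j f)"
    unfolding potential1_def[abs_def] potential2_def[abs_def]
    by (intro has_partial_divide loc_geometric_has_partial g g2 approx1_has_partial f)
  \<comment> \<open>The limit of the regularised Laplacians is computed twice: termwise, and as an
    approximate identity.\<close>
  have "(\<lambda>m. \<Sum>i\<in>UNIV. approx2 i i m f x) \<longlonglongrightarrow> (\<Sum>i\<in>UNIV. lim (\<lambda>m. approx2 i i m f x))"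
    by (intro tendsto_sum loc_geometric_tendsto g2)
  moreover have "(\<lambda>m. \<Sum>i\<in>UNIV. approx2 i i m f x) \<longlonglongrightarrow> - (mass * f x)"
    unfolding approx2_trace[OF f(1)] by (intro tendsto_minus bump_conv_tendsto f)
  ultimately have "(\<Sum>i\<in>UNIV. lim (\<lambda>m. approx2 i i m f x)) = - (mass * f x)"
    by (rule LIMSEQ_unique)
  then show "(\<Sum>i\<in>UNIV. potential2 i i f x) = - f x"
    using mass_pos by (simp add: potential2_def sum_divide_distrib[symmetric])
qed

lemma potential_Ck2:
  assumes f: "integrable lborel f" "continuous_on UNIV f"
    and D: "\<And>i. has_partial i f (f' i)" "\<And>i. continuous_on UNIV (f' i)"
  shows "Ck 2 (\<lambda>x. c + potential f x)" "laplacian (\<lambda>x. c + potential f x) x = - f x"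
proof -
  have 1: "continuous_on UNIV (\<lambda>x. c + potential f x)"
    by (intro continuous_intros potential_C1 f)
  have 2: "has_partial i (\<lambda>x. c + potential f x) (potential1 i f)" for i
    using has_partial_add[OF has_partial_const potential_C1(3)[OF f]] by simp
  note * = Ck_2I[OF 1 potential_C1(2)[OF f] 2 potential_C2(1)[OF f D] potential_C2(2)[OF f D]]
  show "Ck 2 (\<lambda>x. c + potential f x)" by (rule *)
  show "laplacian (\<lambda>x. c + potential f x) x = - f x"
    unfolding laplacian_def *(2) by (rule potential_C2(3)[OF f D])
qed

lemma approx_integrable:
  "integrable lborel f \<Longrightarrow> integrable lborel (\<lambda>y. ker a (4 ^ m) (y - x) * f y)"
  for f :: "real^'n \<Rightarrow> real"
  by (rule integrable_bounded_mult[OF continuous_imp_borel[OF continuous_ker(1)] _ ker_bound[OF a_pos]]) auto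

lemma potential_tendsto:
  assumes "integrable lborel f" "continuous_on UNIV f"
  shows "(\<lambda>m. approx m f x / mass) \<longlonglongrightarrow> potential f x"
  unfolding potential_def using mass_pos
  by (intro tendsto_divide tendsto_const loc_geometric_tendsto approx_loc_geometric assms) auto

lemma potential_mono:
  assumes f: "integrable lborel f" "continuous_on UNIV f"
    and g: "integrable lborel g" "continuous_on UNIV g" and le: "\<And>x. f x \<le> g x"
  shows "potential f x \<le> potential g x"
proof (rule LIMSEQ_le[OF potential_tendsto[OF f] potential_tendsto[OF g]])
  have "approx m f x \<le> approx m g x" for m
    unfolding approx_def conv_def
    by (intro integral_mono approx_integrable f g mult_left_mono le ker_nonneg a_pos)
  then show "\<exists>N. \<forall>n\<ge>N. approx n f x / mass \<le> approx n g x / mass"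
    using mass_pos by (auto intro!: divide_right_mono)
qed

lemma potential_diff:
  assumes f: "integrable lborel f" "continuous_on UNIV f"
    and g: "integrable lborel g" "continuous_on UNIV g"
  shows "potential (\<lambda>x. f x - g x) x = potential f x - potential g x"
proof -
  have "(\<lambda>m. approx m (\<lambda>x. f x - g x) x / mass) \<longlonglongrightarrow> potential (\<lambda>x. f x - g x) x"
    by (intro potential_tendsto continuous_intros Bochner_Integration.integrable_diff f g)
  moreover have "approx m (\<lambda>x. f x - g x) x = approx m f x - approx m g x" for m
    unfolding approx_def conv_def
    using approx_integrable[OF f(1)] approx_integrable[OF g(1)] by (simp add: right_diff_distrib)
  ultimately have "(\<lambda>m. approx m f x / mass - approx m g x / mass) \<longlonglongrightarrow> potential (\<lambda>x. f x - g x) x"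
    by (simp add: diff_divide_distrib)
  then show ?thesis
    by (rule LIMSEQ_unique[OF _ tendsto_diff[OF potential_tendsto[OF f] potential_tendsto[OF g]]])
qed

lemma potential_cmult:
  assumes f: "integrable lborel f" "continuous_on UNIV f"
  shows "potential (\<lambda>x. c * f x) x = c * potential f x"
proof -
  have "(\<lambda>m. approx m (\<lambda>x. c * f x) x / mass) \<longlonglongrightarrow> potential (\<lambda>x. c * f x) x"
    by (intro potential_tendsto continuous_intros f integrable_mult_right)
  moreover have "approx m (\<lambda>x. c * f x) x = c * approx m f x" for m
    unfolding approx_def conv_def by (simp add: mult.left_commute[of _ c])
  ultimately have "(\<lambda>m. c * (approx m f x / mass)) \<longlonglongrightarrow> potential (\<lambda>x. c * f x) x"
    by simp
  then show ?thesis
    by (rule LIMSEQ_unique[OF _ tendsto_mult_left[OF potential_tendsto[OF f]]])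
qed

text \<open>All increments from scale 0 on live in the unit ball about \<open>x\<close>, so the
  singular part of the potential sees only the local size of \<open>f\<close>; the rest is a
  convolution with a bounded kernel.\<close>

lemma potential_local_bound:
  assumes f: "integrable lborel f" "continuous_on UNIV f"
    and S: "\<And>y. y \<in> cball x 1 \<Longrightarrow> \<bar>f y\<bar> \<le> S"
  shows "\<bar>lim (\<lambda>m. approx m f x) - approx 0 f x\<bar> \<le> 2 * (step_const * vol * S)"
proof -
  have S0: "S \<ge> 0" using S[of x] abs_ge_zero[of "f x"] by (simp; linarith)
  have "\<bar>approx (Suc m) f x - approx m f x\<bar> \<le> step_const * vol * S * (1/2) ^ m" for m
  proof -
    have "step_const * vol * S * (1/4) ^ m \<le> step_const * vol * S * (1/2) ^ m"
      using step_const(1) S0 vol_nonneg by (intro mult_left_mono power_mono) auto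
    moreover have "\<bar>approx (Suc m) f x - approx m f x\<bar> \<le> step_const * vol * S * (1/4) ^ m"
      by (rule approx_step_bound[OF f(1) S])
    ultimately show ?thesis by linarith
  qed
  from geometric_steps_limit(2)[of "\<lambda>m. approx m f x", OF this, of 0] show ?thesis by simp
qed

lemma potential_bounded:
  assumes f: "integrable lborel f" "continuous_on UNIV f" and S: "\<And>y. \<bar>f y\<bar> \<le> S"
  obtains M where "\<And>x. \<bar>potential f x\<bar> \<le> M"
proof
  fix x
  let ?B = "2 * (a + 1) * (a + 2)"
  have ker: "\<bar>ker a 1 z\<bar> \<le> ?B" for z :: "real^'n"
    using ker_bound[OF a_pos, of 1 z] by simp
  have "\<bar>approx 0 f x\<bar> \<le> (LINT y|lborel. ?B * \<bar>f y\<bar>)"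
    unfolding approx_def conv_def
  proof (rule integral_abs_bound_integral)
    show "integrable lborel (\<lambda>y. ker a (4 ^ 0) (y - x) * f y)" by (rule approx_integrable[OF f(1)])
    show "integrable lborel (\<lambda>y. ?B * \<bar>f y\<bar>)" using f by simp
    show "\<bar>ker a (4 ^ 0) (y - x) * f y\<bar> \<le> ?B * \<bar>f y\<bar>" for y
      using ker[of "y - x"] by (auto simp: abs_mult intro!: mult_right_mono)
  qed
  then have "\<bar>lim (\<lambda>m. approx m f x)\<bar> \<le> (LINT y|lborel. ?B * \<bar>f y\<bar>) + 2 * (step_const * vol * S)"
    using potential_local_bound[OF f S, of x] by linarith
  then show "\<bar>potential f x\<bar> \<le> ((LINT y|lborel. ?B * \<bar>f y\<bar>) + 2 * (step_const * vol * S)) / mass"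
    using mass_pos by (simp add: potential_def divide_right_mono)
qed

text \<open>The scale-0 part vanishes at infinity because \<open>f\<close> is integrable and the
  kernel decays, the local remainder because \<open>f\<close> itself tends to 0.\<close>

lemma potential_at_infinity:
  assumes f: "integrable lborel f" "continuous_on UNIV f" and lim: "(f \<longlongrightarrow> 0) at_infinity"
  shows "(potential f \<longlongrightarrow> 0) at_infinity"
proof -
  have "(approx 0 f \<longlongrightarrow> 0) at_infinity"
    unfolding approx_def power_0
    by (rule conv_at_infinity[OF continuous_ker(1) ker_bound[OF a_pos] ker_at_infinity[OF a_pos] f(1)]) simp
  moreover have "((\<lambda>x. lim (\<lambda>m. approx m f x) - approx 0 f x) \<longlongrightarrow> 0) at_infinity"
  proof (rule tendstoI)
    fix e :: real assume e: "e > 0"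
    define S where "S = e / (2 * (step_const * vol) + 1)"
    have c: "step_const * vol \<ge> 0" using step_const(1) vol_nonneg by simp
    then have S: "S > 0" using e by (simp add: S_def)
    have "2 * (step_const * vol * S) < (2 * (step_const * vol) + 1) * S"
      using S by (simp add: algebra_simps)
    also have "\<dots> = e" using c by (simp add: S_def)
    finally have Se: "2 * (step_const * vol * S) < e" .
    have "\<forall>\<^sub>F x in at_infinity. dist (f x) 0 < S" using lim S by (rule tendstoD)
    then obtain b where b: "\<And>x. norm x \<ge> b \<Longrightarrow> \<bar>f x\<bar> < S"
      unfolding eventually_at_infinity by auto
    show "\<forall>\<^sub>F x in at_infinity. dist (lim (\<lambda>m. approx m f x) - approx 0 f x) 0 < e"
      unfolding eventually_at_infinity
    proof (intro exI allI impI)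
      \<comment> \<open>The additional 1 keeps the unit ball about \<open>x\<close> in the region
        where \<open>f\<close> is small.\<close>
      fix x :: "real^'n" assume x: "norm x \<ge> b + 1"
      have "\<bar>f y\<bar> \<le> S" if "y \<in> cball x 1" for y
      proof -
        have "norm y \<ge> b"
          using that x norm_triangle_ineq2[of x y] by (simp add: dist_norm)
        then show ?thesis using b[of y] by simp
      qed
      have "\<bar>lim (\<lambda>m. approx m f x) - approx 0 f x\<bar> \<le> 2 * (step_const * vol * S)"
        by (rule potential_local_bound[OF f \<open>\<And>y. y \<in> cball x 1 \<Longrightarrow> \<bar>f y\<bar> \<le> S\<close>])
      then show "dist (lim (\<lambda>m. approx m f x) - approx 0 f x) 0 < e" using Se by simp
    qed
  qed
  ultimately have "((\<lambda>x. approx 0 f x + (lim (\<lambda>m. approx m f x) - approx 0 f x)) \<longlongrightarrow> 0 + 0) at_infinity"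
    by (rule tendsto_add)
  then have "((\<lambda>x. lim (\<lambda>m. approx m f x)) \<longlongrightarrow> 0) at_infinity" by simp
  from tendsto_divide[OF this tendsto_const[of mass]] show ?thesis
    using mass_pos by (simp add: potential_def[abs_def])
qed

end

section \<open>The semilinear equation\<close>

text \<open>Mean value theorem, using derivatives only in the open interval, so that an endpoint 0
  is allowed. The constant is small for small \<open>B\<close> because p > 1.\<close>

lemma powr_lipschitz:
  fixes s t :: real
  assumes "0 \<le> s" "s \<le> B" "0 \<le> t" "t \<le> B" "p > 1"
  shows "\<bar>s powr p - t powr p\<bar> \<le> p * B powr (p - 1) * \<bar>s - t\<bar>"
proof -
  have *: "\<bar>y powr p - x powr p\<bar> \<le> p * B powr (p - 1) * \<bar>y - x\<bar>"
    if xy: "0 \<le> x" "x < y" "y \<le> B" for x y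
  proof -
    have "continuous_on {x..y} (\<lambda>z. z powr p)"
      using xy assms(5) by (intro continuous_on_powr' continuous_intros) auto
    moreover have "((\<lambda>z. z powr p) has_derivative (*) (p * z powr (p - 1))) (at z)" if "x < z" "z < y" for z
      using has_real_derivative_powr[of z p] that xy by (simp add: has_field_derivative_def)
    ultimately obtain z where z: "x < z" "z < y" "y powr p - x powr p = p * z powr (p - 1) * (y - x)"
      using mvt[OF xy(2), of "\<lambda>z. z powr p" "\<lambda>z. (*) (p * z powr (p - 1))"] by blast
    have "z powr (p - 1) \<le> B powr (p - 1)"
      using z xy assms(5) by (intro powr_mono2) auto
    then have "p * z powr (p - 1) * (y - x) \<le> p * B powr (p - 1) * (y - x)"
      using xy assms(5) by (intro mult_right_mono mult_left_mono) auto
    moreover have "0 \<le> p * z powr (p - 1) * (y - x)" using xy assms(5) by simp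
    ultimately show ?thesis using z(3) xy by simp
  qed
  consider "s < t" | "s = t" | "t < s" by linarith
  then show ?thesis
  proof cases
    case 1
    then show ?thesis using *[of s t] assms by (simp add: abs_minus_commute)
  qed (use *[of t s] assms in auto)
qed

lemma continuous_tendsto_imp_bounded:
  fixes f :: "real^'n \<Rightarrow> real"
  assumes "continuous_on UNIV f" "(f \<longlongrightarrow> L) at_infinity"
  obtains S where "\<And>x. \<bar>f x\<bar> \<le> S"
proof -
  have "\<forall>\<^sub>F x in at_infinity. dist (f x) L < 1" using assms(2) by (rule tendstoD) simp
  then obtain b where b: "\<And>x. norm x \<ge> b \<Longrightarrow> dist (f x) L < 1"
    unfolding eventually_at_infinity by auto
  obtain S where S: "\<And>x. x \<in> cball 0 b \<Longrightarrow> \<bar>f x\<bar> \<le> S"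
    using continuous_bounded_on_cball[OF assms(1)] by blast
  have "\<bar>f x\<bar> \<le> max S (\<bar>L\<bar> + 1)" for x
  proof (cases "norm x \<ge> b")
    case True
    then have "\<bar>f x - L\<bar> < 1" using b[of x] by (simp add: dist_real_def)
    then show ?thesis by linarith
  next
    case False
    then show ?thesis using S[of x] by simp
  qed
  then show thesis by (rule that)
qed

text \<open>The hypotheses in the form used by the fixed point argument: \<open>K_int\<close> and
  \<open>K_lim\<close> control the potential of the source at infinity, \<open>K'\<close> supplies
  the C^1 regularity behind its second derivatives.\<close>

locale semilinear = newton a dim_type
  for a :: real and dim_type :: "'n::finite itself" +
  fixes K :: "real^'n \<Rightarrow> real" and K' :: "'n \<Rightarrow> real^'n \<Rightarrow> real" and p :: real
  assumes K_int: "integrable lborel K" and K_cont: "continuous_on UNIV K"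
    and K_nonneg: "\<And>x. K x \<ge> 0" and K_lim: "(K \<longlongrightarrow> 0) at_infinity"
    and K_partial: "\<And>i. has_partial i K (K' i)" and K'_cont: "\<And>i. continuous_on UNIV (K' i)"
    and p: "p > 1"
begin

definition source :: "(real^'n \<Rightarrow> real) \<Rightarrow> real^'n \<Rightarrow> real" where
  "source u x = K x * u x powr p"

definition pot_sup :: real where
  "pot_sup = (SUP x. \<bar>potential K x\<bar>)"

text \<open>The supremum is over a bounded set: a continuous \<open>K\<close> with a limit at
  infinity is bounded, and then so is its potential.\<close>

lemma potential_K_le: "potential K x \<le> pot_sup" and pot_sup_nonneg: "pot_sup \<ge> 0"
proof -
  obtain S where "\<And>x. \<bar>K x\<bar> \<le> S" using continuous_tendsto_imp_bounded[OF K_cont K_lim] by blast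
  then obtain M where "\<And>x. \<bar>potential K x\<bar> \<le> M" using potential_bounded[OF K_int K_cont] by blast
  then have "bdd_above (range (\<lambda>x. \<bar>potential K x\<bar>))" by (intro bdd_aboveI) auto
  then have le: "\<bar>potential K x\<bar> \<le> pot_sup" for x
    unfolding pot_sup_def by (intro cSUP_upper) auto
  show "potential K x \<le> pot_sup" using le[of x] by linarith
  show "pot_sup \<ge> 0" using le[of 0] by linarith
qed

lemma source_le:
  assumes "\<And>x. 0 \<le> u x" "\<And>x. u x \<le> S"
  shows "0 \<le> source u x" "source u x \<le> S powr p * K x"
  using powr_mono2[of p "u x" S] assms K_nonneg p
  by (auto simp: source_def mult.commute[of "K x"] intro!: mult_right_mono)

lemma source_continuous:
  assumes "continuous_on UNIV u" "\<And>x. 0 \<le> u x"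
  shows "continuous_on UNIV (source u)"
  unfolding source_def[abs_def]
  using assms p by (intro continuous_on_mult K_cont continuous_on_powr' continuous_on_const) auto

lemma source_integrable:
  assumes u: "continuous_on UNIV u" "\<And>x. 0 \<le> u x" "\<And>x. u x \<le> S"
  shows "integrable lborel (source u)"
proof (rule Bochner_Integration.integrable_bound)
  show "integrable lborel (\<lambda>x. S powr p * K x)" using K_int by simp
  show "source u \<in> borel_measurable lborel"
    using continuous_imp_borel[OF source_continuous[OF u(1,2)]] by simp
  show "AE x in lborel. norm (source u x) \<le> norm (S powr p * K x)"
    using source_le[of u S, OF u(2,3)] by (intro AE_I2) (simp add: K_nonneg)
qed

lemma source_at_infinity:
  assumes "\<And>x. 0 \<le> u x" "\<And>x. u x \<le> S"
  shows "(source u \<longlongrightarrow> 0) at_infinity"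
proof (rule tendsto_sandwich[OF _ _ tendsto_const])
  show "((\<lambda>x. S powr p * K x) \<longlongrightarrow> 0) at_infinity"
    using K_lim by (rule tendsto_mult_right_zero)
qed (use source_le[of u S, OF assms] in auto)

lemma source_partial:
  assumes u: "\<And>x. u x > 0" "continuous_on UNIV u"
    and D: "\<And>i. has_partial i u (u' i)" "\<And>i. continuous_on UNIV (u' i)"
  obtains d where "\<And>i. has_partial i (source u) (d i)" "\<And>i. continuous_on UNIV (d i)"
proof
  fix i
  show "has_partial i (source u) (\<lambda>x. K' i x * u x powr p + K x * (p * u x powr (p - 1) * u' i x))"
    unfolding source_def[abs_def] by (intro has_partial_mult has_partial_powr K_partial D u)
  show "continuous_on UNIV (\<lambda>x. K' i x * u x powr p + K x * (p * u x powr (p - 1) * u' i x))"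
    using u(1) by (intro continuous_intros K_cont K'_cont D u) (metis less_irrefl)+
qed

text \<open>Chosen to satisfy p (2 b0)^(p-1) (pot_sup + 1) = 1/2, the contraction factor on
  [0, 2 b0]. Adding 1 avoids division by zero.\<close>

definition b0 :: real where
  "b0 = (1 / (2 * p * (pot_sup + 1))) powr (1 / (p - 1)) / 2"

lemma b0_pos: "b0 > 0"
  unfolding b0_def using p pot_sup_nonneg by simp

lemma b0_small: "p * (2 * b0) powr (p - 1) * pot_sup \<le> 1 / 2"
proof -
  have "(2 * b0) powr (p - 1) = 1 / (2 * p * (pot_sup + 1))"
    unfolding b0_def using p pot_sup_nonneg by (simp add: powr_powr)
  then have "p * (2 * b0) powr (p - 1) * pot_sup = pot_sup / (2 * (pot_sup + 1))"
    using p by simp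
  also have "\<dots> \<le> 1 / 2" using pot_sup_nonneg by (simp add: field_simps)
  finally show ?thesis .
qed

text \<open>The difference of the sources is at most a multiple of \<open>K\<close>, so monotonicity
  reduces the estimate to the potential of \<open>K\<close> itself. The bound is proved on one side
  and the roles of \<open>u\<close> and \<open>v\<close> are then exchanged.\<close>

lemma potential_contraction:
  assumes u: "continuous_on UNIV u" "\<And>x. 0 \<le> u x" "\<And>x. u x \<le> 2 * b0"
    and v: "continuous_on UNIV v" "\<And>x. 0 \<le> v x" "\<And>x. v x \<le> 2 * b0"
    and d: "\<And>x. \<bar>u x - v x\<bar> \<le> d"
  shows "\<bar>potential (source u) x - potential (source v) x\<bar> \<le> d / 2"
proof -
  have *: "potential (source u) x - potential (source v) x \<le> d / 2"
    if u: "continuous_on UNIV u" "\<And>x. 0 \<le> u x" "\<And>x. u x \<le> 2 * b0"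
    and v: "continuous_on UNIV v" "\<And>x. 0 \<le> v x" "\<And>x. v x \<le> 2 * b0"
    and d: "\<And>x. \<bar>u x - v x\<bar> \<le> d" for u v
  proof -
    let ?c = "p * (2 * b0) powr (p - 1) * d"
    have d0: "d \<ge> 0" using d[of 0] abs_ge_zero[of "u 0 - v 0"] by linarith
    have fu: "integrable lborel (source u)" "continuous_on UNIV (source u)"
      by (rule source_integrable[OF u]) (rule source_continuous[OF u(1,2)])
    have fv: "integrable lborel (source v)" "continuous_on UNIV (source v)"
      by (rule source_integrable[OF v]) (rule source_continuous[OF v(1,2)])
    have le: "source u x - source v x \<le> ?c * K x" for x
    proof -
      have "u x powr p - v x powr p \<le> p * (2 * b0) powr (p - 1) * \<bar>u x - v x\<bar>"
        using powr_lipschitz[OF u(2)[of x] u(3)[of x] v(2)[of x] v(3)[of x] p] by linarith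
      also have "\<dots> \<le> ?c" using d[of x] p by (intro mult_left_mono) auto
      finally have "K x * (u x powr p - v x powr p) \<le> K x * ?c"
        using K_nonneg by (rule mult_left_mono)
      then show ?thesis by (simp add: source_def algebra_simps)
    qed
    have "potential (\<lambda>x. source u x - source v x) x \<le> potential (\<lambda>x. ?c * K x) x"
      by (rule potential_mono) (use fu fv K_int K_cont le in \<open>auto intro!: continuous_intros\<close>)
    then have "potential (source u) x - potential (source v) x \<le> ?c * potential K x"
      by (simp only: potential_diff[OF fu fv] potential_cmult[OF K_int K_cont])
    also have "\<dots> \<le> ?c * pot_sup" using d0 p potential_K_le by (intro mult_left_mono) auto
    also have "\<dots> = (p * (2 * b0) powr (p - 1) * pot_sup) * d" by (simp only: mult_ac)
    also have "\<dots> \<le> 1 / 2 * d" using b0_small d0 by (rule mult_right_mono)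
    finally show ?thesis by simp
  qed
  have "\<bar>v x - u x\<bar> \<le> d" for x using d[of x] by (simp add: abs_minus_commute)
  from *[OF v u this] *[OF u v d] show ?thesis by linarith
qed

section \<open>Fixed point iteration and the solution with limit beta\<close>

fun iter :: "real \<Rightarrow> nat \<Rightarrow> real^'n \<Rightarrow> real" where
  "iter \<beta> 0 x = \<beta>"
| "iter \<beta> (Suc k) x = \<beta> + potential (source (iter \<beta> k)) x"

lemma source_zero: "source (\<lambda>_. 0) = (\<lambda>_. 0)"
  using p by (simp add: source_def fun_eq_iff)

lemma potential_zero: "potential (\<lambda>_. 0) x = 0"
  using potential_cmult[OF K_int K_cont, of 0 x] by simp

text \<open>Contraction compared with the zero function, whose source and potential vanish, halves
  the bound 2 \<beta>. Hence the functions with values in [\<beta>, 2 \<beta>] are mapped to such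
  functions.\<close>

lemma half_potential_bounds:
  assumes u: "continuous_on UNIV u" "\<And>x. 0 \<le> u x" "\<And>x. u x \<le> 2 * \<beta>" and \<beta>: "\<beta> \<le> b0"
  shows "0 \<le> potential (source u) x" "potential (source u) x \<le> \<beta>"
proof -
  have u2: "u x \<le> 2 * b0" for x using u(3)[of x] \<beta> by linarith
  have "\<bar>potential (source u) x - potential (source (\<lambda>_. 0)) x\<bar> \<le> 2 * \<beta> / 2"
    by (rule potential_contraction[OF u(1,2) u2]) (use u b0_pos in auto)
  then show "potential (source u) x \<le> \<beta>" by (simp add: source_zero potential_zero)
  have "potential (\<lambda>_. 0) x \<le> potential (source u) x"
    by (rule potential_mono[OF _ _ source_integrable[OF u] source_continuous[OF u(1,2)] source_le(1)[OF u(2,3)]])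
       auto
  then show "0 \<le> potential (source u) x" by (simp add: potential_zero)
qed

lemma iter_props:
  assumes \<beta>: "0 < \<beta>" "\<beta> \<le> b0"
  shows "continuous_on UNIV (iter \<beta> k)" "\<beta> \<le> iter \<beta> k x" "iter \<beta> k x \<le> 2 * \<beta>"
proof -
  have "continuous_on UNIV (iter \<beta> k) \<and> (\<forall>x. \<beta> \<le> iter \<beta> k x \<and> iter \<beta> k x \<le> 2 * \<beta>)"
  proof (induction k)
    case 0
    have "iter \<beta> 0 = (\<lambda>_. \<beta>)" by auto
    then show ?case using \<beta> by simp
  next
    case (Suc k)
    have u: "continuous_on UNIV (iter \<beta> k)" "\<And>x. 0 \<le> iter \<beta> k x" "\<And>x. iter \<beta> k x \<le> 2 * \<beta>"
      using Suc \<beta> by (auto intro: order_trans[of 0 \<beta>])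
    have "iter \<beta> (Suc k) = (\<lambda>x. \<beta> + potential (source (iter \<beta> k)) x)" by auto
    then show ?case
      using half_potential_bounds[OF u \<beta>(2)] potential_C1(1)[OF source_integrable[OF u] source_continuous[OF u(1,2)]]
      by (auto intro!: continuous_intros)
  qed
  then show "continuous_on UNIV (iter \<beta> k)" "\<beta> \<le> iter \<beta> k x" "iter \<beta> k x \<le> 2 * \<beta>" by auto
qed

lemma iter_admissible:
  assumes \<beta>: "0 < \<beta>" "\<beta> \<le> b0"
  shows "continuous_on UNIV (iter \<beta> k)" "\<And>x. 0 \<le> iter \<beta> k x" "\<And>x. iter \<beta> k x \<le> 2 * b0"
  using iter_props[OF \<beta>] \<beta> by (auto intro: order_trans[of 0 \<beta>] order_trans[of _ "2 * \<beta>"])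

text \<open>The first step is at most \<beta> because the first iterate lies in
  [\<beta>, 2 \<beta>]; the contraction halves every later step.\<close>

lemma iter_step:
  assumes \<beta>: "0 < \<beta>" "\<beta> \<le> b0"
  shows "\<bar>iter \<beta> (Suc k) x - iter \<beta> k x\<bar> \<le> \<beta> * (1/2) ^ k"
proof (induction k arbitrary: x)
  case 0
  show ?case using iter_props(2,3)[OF \<beta>, where k = "Suc 0" and x = x] by simp
next
  case (Suc k)
  have "\<bar>potential (source (iter \<beta> (Suc k))) x - potential (source (iter \<beta> k)) x\<bar> \<le> \<beta> * (1/2) ^ k / 2"
    by (rule potential_contraction[OF iter_admissible[OF \<beta>] iter_admissible[OF \<beta>] Suc])
  then show ?case by simp
qed

definition sol :: "real \<Rightarrow> real^'n \<Rightarrow> real" where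
  "sol \<beta> x = lim (\<lambda>k. iter \<beta> k x)"

context
  fixes \<beta> :: real
  assumes \<beta>: "0 < \<beta>" "\<beta> \<le> b0"
begin

lemma iter_tendsto: "(\<lambda>k. iter \<beta> k x) \<longlonglongrightarrow> sol \<beta> x"
  unfolding sol_def by (rule geometric_steps_limit[OF iter_step[OF \<beta>]])

lemma sol_iter_dist: "\<bar>sol \<beta> x - iter \<beta> k x\<bar> \<le> 2 * \<beta> * (1/2) ^ k"
  unfolding sol_def by (rule geometric_steps_limit[OF iter_step[OF \<beta>]])

lemma sol_continuous: "continuous_on UNIV (sol \<beta>)"
  unfolding sol_def[abs_def]
proof (rule loc_geometric_continuous)
  show "loc_geometric (iter \<beta>)"
    unfolding loc_geometric_def using iter_step[OF \<beta>] by blast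
qed (rule iter_props[OF \<beta>])

lemma sol_bounds: "\<beta> \<le> sol \<beta> x" "sol \<beta> x \<le> 2 * \<beta>"
  by (rule LIMSEQ_le_const[OF iter_tendsto] LIMSEQ_le_const2[OF iter_tendsto]; use iter_props[OF \<beta>] in blast)+

lemma sol_admissible: "0 \<le> sol \<beta> x" "sol \<beta> x \<le> 2 * b0"
  using sol_bounds[of x] \<beta> by auto

lemma sol_fixpoint: "sol \<beta> x = \<beta> + potential (source (sol \<beta>)) x"
proof (rule LIMSEQ_unique)
  show "(\<lambda>k. iter \<beta> (Suc k) x) \<longlonglongrightarrow> sol \<beta> x"
    by (rule LIMSEQ_Suc[OF iter_tendsto])
  have le: "norm (iter \<beta> (Suc k) x - (\<beta> + potential (source (sol \<beta>)) x)) \<le> \<beta> * (1/2) ^ k" for k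
  proof -
    have "\<bar>iter \<beta> k x - sol \<beta> x\<bar> \<le> 2 * \<beta> * (1/2) ^ k" for x
      using sol_iter_dist[of x k] by (simp add: abs_minus_commute)
    from potential_contraction[OF iter_admissible[OF \<beta>] sol_continuous sol_admissible this]
    show ?thesis by simp
  qed
  have "(\<lambda>k. \<beta> * (1/2) ^ k) \<longlonglongrightarrow> 0"
    using LIMSEQ_power_zero[of "1/2::real"] by (intro tendsto_mult_right_zero) auto
  then have "(\<lambda>k. iter \<beta> (Suc k) x - (\<beta> + potential (source (sol \<beta>)) x)) \<longlonglongrightarrow> 0"
    by (rule Lim_null_comparison[OF always_eventually, rotated]) (use le in blast)
  then show "(\<lambda>k. iter \<beta> (Suc k) x) \<longlonglongrightarrow> \<beta> + potential (source (sol \<beta>)) x"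
    by (simp only: LIM_zero_iff)
qed

lemmas sol_source = source_integrable[OF sol_continuous sol_admissible]
  source_continuous[OF sol_continuous sol_admissible(1)]

lemma sol_eq: "sol \<beta> = (\<lambda>x. \<beta> + potential (source (sol \<beta>)) x)"
  using sol_fixpoint by blast

text \<open>Bootstrap: continuity of the fixed point makes its potential C^1, hence the fixed point
  is C^1; being at least \<beta> > 0 it has a C^1 source, and the potential is then C^2.\<close>

lemma sol_solution: "Ck 2 (sol \<beta>)" "laplacian (sol \<beta>) x = - source (sol \<beta>) x"
proof -
  have "has_partial i (\<lambda>x. \<beta> + potential (source (sol \<beta>)) x) (\<lambda>x. 0 + potential1 i (source (sol \<beta>)) x)" for i
    by (intro has_partial_add has_partial_const potential_C1 sol_source)
  then have D: "has_partial i (sol \<beta>) (potential1 i (source (sol \<beta>)))" for i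
    unfolding sol_eq[symmetric] by simp
  have pos: "sol \<beta> x > 0" for x using sol_bounds(1)[of x] \<beta> by linarith
  obtain d where d: "\<And>i. has_partial i (source (sol \<beta>)) (d i)" "\<And>i. continuous_on UNIV (d i)"
    using source_partial[OF pos sol_continuous D potential_C1(2)[OF sol_source]] by blast
  show "Ck 2 (sol \<beta>)" "laplacian (sol \<beta>) x = - source (sol \<beta>) x"
    using potential_Ck2[OF sol_source d, of \<beta>] unfolding sol_eq[symmetric] by auto
qed

lemma sol_at_infinity: "(sol \<beta> \<longlongrightarrow> \<beta>) at_infinity"
proof -
  have "(potential (source (sol \<beta>)) \<longlongrightarrow> 0) at_infinity"
    by (intro potential_at_infinity sol_source source_at_infinity[OF sol_admissible])
  then have "((\<lambda>x. \<beta> + potential (source (sol \<beta>)) x) \<longlongrightarrow> \<beta> + 0) at_infinity"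
    by (intro tendsto_intros)
  then show ?thesis unfolding sol_eq[symmetric] by simp
qed

lemma sol_minimal:
  assumes w: "Ck 2 w" "\<And>x. laplacian w x + source w x = 0" "\<And>x. w x \<ge> 0" "(w \<longlongrightarrow> \<beta>) at_infinity"
  shows "sol \<beta> x \<le> w x"
proof -
  have cont: "continuous_on UNIV w" and D: "\<And>i. has_partial i w (pd [i] w)" "\<And>i. continuous_on UNIV (pd [i] w)"
    and E: "\<And>i. has_partial i (pd [i] w) (pd [i, i] w)"
    using w(1) unfolding Ck_2_iff by blast+
  obtain S where "\<And>x. \<bar>w x\<bar> \<le> S" using continuous_tendsto_imp_bounded[OF cont w(4)] by blast
  then have S: "w x \<le> S" for x using abs_le_D1 by blast
  have lap: "(\<Sum>i\<in>UNIV. pd [i, i] w x) = - source w x" for x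
    using w(2)[of x] unfolding laplacian_def by linarith
  \<comment> \<open>\<open>w\<close> is superharmonic because its source is nonnegative; the
    resulting positivity makes the source of \<open>w\<close> differentiable.\<close>
  have "w x \<ge> \<beta>" for x
    by (rule superharmonic_ge_limit[OF cont D(1) E _ w(4)]) (simp only: lap source_le(1)[OF w(3) S] neg_le_0_iff_le)
  then have pos: "w x > 0" for x using \<beta>(1) by (rule less_le_trans[rotated])
  obtain d where d: "\<And>i. has_partial i (source w) (d i)" "\<And>i. continuous_on UNIV (d i)"
    using source_partial[OF pos cont D] by blast
  note f = source_integrable[OF cont w(3) S] source_continuous[OF cont w(3)]
  have rep: "\<beta> + potential (source w) x \<le> w x" for x
  proof -
    have "w x - potential (source w) x \<ge> \<beta>"
    proof (rule superharmonic_ge_limit)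
      show "continuous_on UNIV (\<lambda>x. w x - potential (source w) x)"
        by (intro continuous_intros cont potential_C1 f)
      show "has_partial i (\<lambda>x. w x - potential (source w) x) (\<lambda>x. pd [i] w x - potential1 i (source w) x)" for i
        by (intro has_partial_diff D potential_C1 f)
      show "has_partial i (\<lambda>x. pd [i] w x - potential1 i (source w) x)
          (\<lambda>x. pd [i, i] w x - potential2 i i (source w) x)" for i
        by (intro has_partial_diff E potential_C2(2)[OF f d])
      show "(\<Sum>i\<in>UNIV. pd [i, i] w x - potential2 i i (source w) x) \<le> 0" for x
        unfolding sum_subtractf lap potential_C2(3)[OF f d] by simp
      have "(potential (source w) \<longlongrightarrow> 0) at_infinity"
        by (intro potential_at_infinity f source_at_infinity[OF w(3) S])
      from tendsto_diff[OF w(4) this]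
      show "((\<lambda>x. w x - potential (source w) x) \<longlongrightarrow> \<beta>) at_infinity" by simp
    qed
    then show ?thesis by simp
  qed
  \<comment> \<open>The right-hand side of the fixed point equation is monotone, so domination
    passes from one iterate to the next, with \<open>rep\<close> closing each step.\<close>
  have "iter \<beta> k x \<le> w x" for k x
  proof (induction k arbitrary: x)
    case 0
    show ?case using \<open>\<And>x. w x \<ge> \<beta>\<close> by simp
  next
    case (Suc k)
    note u = iter_admissible[OF \<beta>, of k]
    have "source (iter \<beta> k) x \<le> source w x" for x
      unfolding source_def using Suc u p K_nonneg by (intro mult_left_mono powr_mono2) auto
    then have "potential (source (iter \<beta> k)) x \<le> potential (source w) x"
      by (intro potential_mono source_integrable[OF u] source_continuous[OF u(1,2)] f)
    then show ?case using rep[of x] by simp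
  qed
  then show ?thesis
    by (intro LIMSEQ_le_const2[OF iter_tendsto]) blast
qed

end

section \<open>Dependence on the limit beta\<close>

lemma sol_mono:
  assumes "0 < \<beta>" "\<beta> \<le> \<gamma>" "\<gamma> \<le> b0"
  shows "sol \<beta> x \<le> sol \<gamma> x"
proof -
  have \<beta>: "0 < \<beta>" "\<beta> \<le> b0" and \<gamma>: "0 < \<gamma>" "\<gamma> \<le> b0" using assms by auto
  have "iter \<beta> k x \<le> iter \<gamma> k x" for k x
  proof (induction k arbitrary: x)
    case (Suc k)
    note u = iter_admissible[OF \<beta>, of k] and v = iter_admissible[OF \<gamma>, of k]
    have "source (iter \<beta> k) x \<le> source (iter \<gamma> k) x" for x
      unfolding source_def using Suc u p K_nonneg by (intro mult_left_mono powr_mono2) auto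
    then have "potential (source (iter \<beta> k)) x \<le> potential (source (iter \<gamma> k)) x"
      by (intro potential_mono source_integrable[OF u] source_continuous[OF u(1,2)]
          source_integrable[OF v] source_continuous[OF v(1,2)])
    then show ?case using assms by simp
  qed (use assms in simp)
  then show ?thesis
    by (intro LIMSEQ_le[OF iter_tendsto[OF \<beta>] iter_tendsto[OF \<gamma>]]) blast
qed

text \<open>The constant 2 reproduces itself: one step adds |\<beta> - \<gamma>| to half of 2
  |\<beta> - \<gamma>|.\<close>

lemma sol_lipschitz:
  assumes \<beta>: "0 < \<beta>" "\<beta> \<le> b0" and \<gamma>: "0 < \<gamma>" "\<gamma> \<le> b0"
  shows "\<bar>sol \<beta> x - sol \<gamma> x\<bar> \<le> 2 * \<bar>\<beta> - \<gamma>\<bar>"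
proof -
  have "\<bar>iter \<beta> k x - iter \<gamma> k x\<bar> \<le> 2 * \<bar>\<beta> - \<gamma>\<bar>" for k x
  proof (induction k arbitrary: x)
    case (Suc k)
    have "\<bar>potential (source (iter \<beta> k)) x - potential (source (iter \<gamma> k)) x\<bar> \<le> 2 * \<bar>\<beta> - \<gamma>\<bar> / 2"
      by (rule potential_contraction[OF iter_admissible[OF \<beta>] iter_admissible[OF \<gamma>] Suc])
    moreover have "iter \<beta> (Suc k) x - iter \<gamma> (Suc k) x =
        (\<beta> - \<gamma>) + (potential (source (iter \<beta> k)) x - potential (source (iter \<gamma> k)) x)"
      by simp
    ultimately show ?case
      by (simp only:) (rule order_trans[OF abs_triangle_ineq], simp)
  qed simp
  moreover have "(\<lambda>k. \<bar>iter \<beta> k x - iter \<gamma> k x\<bar>) \<longlonglongrightarrow> \<bar>sol \<beta> x - sol \<gamma> x\<bar>"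
    by (intro tendsto_intros iter_tendsto \<beta> \<gamma>)
  ultimately show ?thesis by (intro LIMSEQ_le_const2) blast+
qed

end

text \<open>For nonnegative functions gauge integrability is absolute, hence Lebesgue; continuity
  gives Borel measurability, which passes from the completed measure to
  \<open>lborel\<close>.\<close>

lemma nonneg_integrable_on_imp_lborel:
  fixes K :: "real^'n \<Rightarrow> real"
  assumes "K integrable_on UNIV" "continuous_on UNIV K" "\<And>x. K x \<ge> 0"
  shows "integrable lborel K"
proof -
  have "K absolutely_integrable_on UNIV"
    using assms by (intro nonnegative_absolutely_integrable_1) auto
  then have "integrable (completion lborel) K"
    by (simp add: set_integrable_def)
  then show ?thesis
    using continuous_imp_borel[OF assms(2)] by (subst (asm) integrable_completion) auto
qed

lemma powr_decay_tendsto_0: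
  fixes K :: "'a::real_normed_vector \<Rightarrow> real"
  assumes "\<And>x. K x \<ge> 0" "\<And>x. norm x \<ge> R \<Longrightarrow> K x \<le> C * norm x powr (- l)" "l > 0"
  shows "(K \<longlongrightarrow> 0) at_infinity"
proof (rule tendsto_sandwich[OF _ _ tendsto_const])
  have "((\<lambda>x::'a. norm x powr (- l)) \<longlongrightarrow> 0) at_infinity"
    using assms(3) by (intro tendsto_neg_powr filterlim_norm_at_top) auto
  from tendsto_mult_left[OF this, of C] show "((\<lambda>x::'a. C * norm x powr (- l)) \<longlongrightarrow> 0) at_infinity"
    by simp
  show "\<forall>\<^sub>F x in at_infinity. K x \<le> C * norm x powr (- l)"
    unfolding eventually_at_infinity using assms(2) by blast
qed (use assms in auto)

theorem theorem4p2:
  fixes K :: "real^'n \<Rightarrow> real"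
  assumes n3: "CARD('n) \<ge> 3"
    and K_smooth: "smooth K"
    and K_nonneg: "\<forall>x. K x \<ge> 0"
    and K_nonzero: "\<exists>x. K x \<noteq> 0"
    and K_int: "K integrable_on UNIV"
    and K_decay: "\<exists>l>2. \<exists>C R. \<forall>x. norm x \<ge> R \<longrightarrow> K x \<le> C * norm x powr (-l)"
  shows "\<exists>\<beta>0>0. \<exists>U :: real \<Rightarrow> real^'n \<Rightarrow> real.
     (\<forall>\<beta>\<in>{0<..<\<beta>0}.
        is_solution K (U \<beta>) \<and>
        (\<forall>x. U \<beta> x > 0) \<and>
        (\<forall>x. U \<beta> x \<ge> \<beta>) \<and>
        ((U \<beta>) \<longlongrightarrow> \<beta>) at_infinity \<and>
        (\<forall>w. is_solution K w \<and> (\<forall>x. w x \<ge> 0) \<and> (w \<longlongrightarrow> \<beta>) at_infinity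
             \<longrightarrow> (\<forall>x. U \<beta> x \<le> w x))) \<and>
     (\<forall>x. continuous_on {0<..<\<beta>0} (\<lambda>\<beta>. U \<beta> x)) \<and>
     (\<forall>x. \<forall>\<beta>1\<in>{0<..<\<beta>0}. \<forall>\<beta>2\<in>{0<..<\<beta>0}. \<beta>1 \<le> \<beta>2 \<longrightarrow> U \<beta>1 x \<le> U \<beta>2 x)"
proof -
  let ?a = "(real CARD('n) - 2) / 2" and ?p = "real CARD('n) / (real CARD('n) - 2)"
  have "Ck 2 K" using K_smooth by (simp add: smooth_def)
  then have cont: "continuous_on UNIV K"
    and D: "\<And>i. has_partial i K (pd [i] K)" "\<And>i. continuous_on UNIV (pd [i] K)"
    unfolding Ck_2_iff by blast+
  obtain l C R where lim: "l > 2" "\<And>x. norm x \<ge> R \<Longrightarrow> K x \<le> C * norm x powr (- l)"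
    using K_decay by blast
  \<comment> \<open>The assumption n >= 3 makes both a = (n-2)/2 positive and p = n/(n-2) greater
    than 1.\<close>
  interpret semilinear ?a "TYPE('n)" K "\<lambda>i. pd [i] K" ?p
  proof
    show "(K \<longlongrightarrow> 0) at_infinity"
      by (rule powr_decay_tendsto_0[where l = l]) (use K_nonneg lim in auto)
    show "integrable lborel K"
      by (rule nonneg_integrable_on_imp_lborel[OF K_int cont]) (use K_nonneg in auto)
  qed (use n3 cont D K_nonneg in \<open>auto simp: field_simps\<close>)
  have solution_iff: "is_solution K u \<longleftrightarrow> Ck 2 u \<and> (\<forall>x. laplacian u x + source u x = 0)" for u
    by (simp add: is_solution_def source_def)
  have lipschitz: "2-lipschitz_on {0<..<b0} (\<lambda>\<beta>. sol \<beta> x)" for x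
    by (rule lipschitz_onI) (use sol_lipschitz in \<open>auto simp: dist_real_def\<close>)
  show ?thesis
  proof (intro exI conjI ballI allI impI)
    show "b0 > 0" by (rule b0_pos)
    show "continuous_on {0<..<b0} (\<lambda>\<beta>. sol \<beta> x)" for x
      by (rule lipschitz_on_continuous_on[OF lipschitz])
    show "sol \<beta>1 x \<le> sol \<beta>2 x" if "\<beta>1 \<in> {0<..<b0}" "\<beta>2 \<in> {0<..<b0}" "\<beta>1 \<le> \<beta>2" for x \<beta>1 \<beta>2
      using that by (intro sol_mono) auto
    fix \<beta> assume "\<beta> \<in> {0<..<b0}"
    then have \<beta>: "0 < \<beta>" "\<beta> \<le> b0" by auto
    show "is_solution K (sol \<beta>)"
      using sol_solution[OF \<beta>] by (simp add: solution_iff)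
    show "sol \<beta> x \<ge> \<beta>" for x by (rule sol_bounds[OF \<beta>])
    then show "sol \<beta> x > 0" for x using \<beta>(1) by (rule less_le_trans[rotated])
    show "(sol \<beta> \<longlongrightarrow> \<beta>) at_infinity" by (rule sol_at_infinity[OF \<beta>])
    fix w x assume "is_solution K w \<and> (\<forall>x. 0 \<le> w x) \<and> (w \<longlongrightarrow> \<beta>) at_infinity"
    then show "sol \<beta> x \<le> w x"
      by (intro sol_minimal[OF \<beta>]) (auto simp: solution_iff)
  qed
qed

end
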